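(* Let $K$ be a finite set, let $k(x,y)\ge 0$ ($x\ne y\in K$) be the transition rates of an irreducible Markov jump process $X_t$ on $K$ with backward generator $L$ and unique stationary distribution $\rho^s$. Let $f:K\to\mathbb{R}$ with $\langle f\rangle^s=0$, and let $V:K\to\mathbb{R}$ be the solution of $LV(x)+f(x)=0$ for all $x\in K$ with $\langle V\rangle^s=0$. For $x,y\in K$ put $$\tilde v(x,y):=\left\langle\int_0^{T_{K\setminus\{y\}}}[f(X_t)-\langle f\rangle^s]\,\mathrm{d}t\ \Big|\ X_0=x\right\rangle .$$ Then for all $x,y\in K$, $$V(x)-V(y)=\tilde v(x,y)$$ and $$|V(x)-V(y)|\le \|f\|\,\min\{\tau(x,y),\tau(y,x)\},$$ where $\|f\|:=\max_{z\in K}|f(z)-\langle f\rangle^s|$ and $\tau(x,y)$ is the mean first-passage time to reach $y$ from $x$.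
   Context: The backward generator acts on functions $h:K\to\mathbb{R}$ by $Lh(x)=\sum_y k(x,y)[h(y)-h(x)]$. Irreducibility means that the digraph with vertex set $K$ and arcs $(x,y)$ for $k(x,y)>0$ is strongly connected. The stationary distribution $\rho^s>0$ is the unique probability distribution with $\rho^sL=0$, and $\langle h\rangle^s=\sum_x\rho^s(x)h(x)$. $\langle\,\cdot\mid X_0=x\rangle$ denotes expectation for the process started at $x$. For $H\subset K$, $T_H:=\inf\{t\ge 0: X_t\notin H\}$ is the escape time from $H$ (so $T_H=0$ if $X_0\notin H$); thus $T_{K\setminus\{y\}}$ is the first hitting time of $y$, and $\tau(x,y)=\langle T_{K\setminus\{y\}}\mid X_0=x\rangle$. *)

theory Defs
  imports "HOL-Probability.Probability" "Graph_Theory.Digraph_Component"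
begin

definition generator :: "('a::finite \<Rightarrow> 'a \<Rightarrow> real) \<Rightarrow> ('a \<Rightarrow> real) \<Rightarrow> 'a \<Rightarrow> real" where
  "generator k h x = (\<Sum>y\<in>UNIV. k x y * (h y - h x))"

text \<open>The diagonal of \<open>k\<close> carries no information: it does not contribute to the generator,
  and loops are left out of the digraph.\<close>

definition rate_digraph :: "('a::finite \<Rightarrow> 'a \<Rightarrow> real) \<Rightarrow> ('a, 'a \<times> 'a) pre_digraph" where
  "rate_digraph k = \<lparr>verts = UNIV, arcs = {(x, y). x \<noteq> y \<and> 0 < k x y}, tail = fst, head = snd\<rparr>"

definition irreducible_rates :: "('a::finite \<Rightarrow> 'a \<Rightarrow> real) \<Rightarrow> bool" where
  "irreducible_rates k \<longleftrightarrow> strongly_connected (rate_digraph k)"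

definition mean :: "('a::finite \<Rightarrow> real) \<Rightarrow> ('a \<Rightarrow> real) \<Rightarrow> real" where
  "mean \<rho> h = (\<Sum>x\<in>UNIV. \<rho> x * h x)"

text \<open>The equation \<open>\<rho> L = 0\<close> is expressed by letting the row vector \<open>\<rho> L\<close> act on
  all functions.\<close>

definition stationary_distribution ::
    "('a::finite \<Rightarrow> 'a \<Rightarrow> real) \<Rightarrow> ('a \<Rightarrow> real) \<Rightarrow> bool" where
  "stationary_distribution k \<rho> \<longleftrightarrow>
     (\<forall>x. 0 \<le> \<rho> x) \<and> (\<Sum>x\<in>UNIV. \<rho> x) = 1 \<and> (\<forall>h. mean \<rho> (generator k h) = 0)"

text \<open>The \<open>(x, y)\<close> entry of \<open>exp (t L)\<close>, as the exponential series
  applied to the indicator function of \<open>y\<close>.\<close>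

definition transition_prob :: "('a::finite \<Rightarrow> 'a \<Rightarrow> real) \<Rightarrow> real \<Rightarrow> 'a \<Rightarrow> 'a \<Rightarrow> real" where
  "transition_prob k t x y =
     (\<Sum>n. t ^ n / fact n * ((generator k ^^ n) (indicator {y})) x)"

text \<open>A time-homogeneous Markov process \<open>X\<close> (time parameter \<open>t \<ge> 0\<close>) with generator \<open>L\<close>:
  \<open>P x\<close> is the law of the process started at \<open>x\<close>, all laws living on one measurable space.
  The Markov property is given through the finite-dimensional distributions, with transition
  semigroup \<open>exp (t L)\<close>; the case \<open>n = 0\<close> says that \<open>X 0 = x\<close> almost surely under \<open>P x\<close>.
  Right continuity is with respect to the discrete topology on the state space, so that
  paths stay constant for a positive time after each instant.\<close>

locale markov_jump_process =
  fixes k :: "'a::finite \<Rightarrow> 'a \<Rightarrow> real"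
    and P :: "'a \<Rightarrow> 'w measure"
    and X :: "real \<Rightarrow> 'w \<Rightarrow> 'a"
  assumes rates_nonneg: "x \<noteq> y \<Longrightarrow> 0 \<le> k x y"
    and prob_space_P: "prob_space (P x)"
    and sets_P: "sets (P x) = sets (P y)"
    and measurable_X: "0 \<le> t \<Longrightarrow> X t \<in> P x \<rightarrow>\<^sub>M count_space UNIV"
    and right_continuous_X:
      "\<omega> \<in> space (P x) \<Longrightarrow> 0 \<le> t \<Longrightarrow> \<forall>\<^sub>F s in at_right t. X s \<omega> = X t \<omega>"
    and finite_dim_distributions:
      "\<And>n (t :: nat \<Rightarrow> real) (z :: nat \<Rightarrow> 'a).
        t 0 = 0 \<Longrightarrow> z 0 = x \<Longrightarrow> (\<And>i. i < n \<Longrightarrow> t i \<le> t (Suc i)) \<Longrightarrow>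
        measure (P x) {\<omega> \<in> space (P x). \<forall>i\<le>n. X (t i) \<omega> = z i} =
          (\<Prod>i<n. transition_prob k (t (Suc i) - t i) (z i) (z (Suc i)))"

definition escape_time :: "(real \<Rightarrow> 'w \<Rightarrow> 'a) \<Rightarrow> 'a set \<Rightarrow> 'w \<Rightarrow> ereal" where
  "escape_time X H \<omega> = Inf (ereal ` {t. 0 \<le> t \<and> X t \<omega> \<notin> H})"

definition mean_first_passage_time ::
    "('a \<Rightarrow> 'w measure) \<Rightarrow> (real \<Rightarrow> 'w \<Rightarrow> 'a) \<Rightarrow> 'a \<Rightarrow> 'a \<Rightarrow> ennreal" where
  "mean_first_passage_time P X x y = (\<integral>\<^sup>+\<omega>. e2ennreal (escape_time X (UNIV - {y}) \<omega>) \<partial>P x)"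

definition accumulated_excess ::
    "(real \<Rightarrow> 'w \<Rightarrow> 'a::finite) \<Rightarrow> ('a \<Rightarrow> real) \<Rightarrow> ('a \<Rightarrow> real) \<Rightarrow> 'a \<Rightarrow> 'w \<Rightarrow> real" where
  "accumulated_excess X \<rho> f y \<omega> =
     (LBINT t=0..escape_time X (UNIV - {y}) \<omega>. (f (X t \<omega>) - mean \<rho> f))"

definition v_tilde ::
    "('a::finite \<Rightarrow> 'w measure) \<Rightarrow> (real \<Rightarrow> 'w \<Rightarrow> 'a) \<Rightarrow> ('a \<Rightarrow> real) \<Rightarrow> ('a \<Rightarrow> real)
      \<Rightarrow> 'a \<Rightarrow> 'a \<Rightarrow> real" where
  "v_tilde P X \<rho> f x y = (\<integral>\<omega>. accumulated_excess X \<rho> f y \<omega> \<partial>P x)"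

definition centered_norm :: "('a::finite \<Rightarrow> real) \<Rightarrow> ('a \<Rightarrow> real) \<Rightarrow> real" where
  "centered_norm \<rho> f = Max (range (\<lambda>z. \<bar>f z - mean \<rho> f\<bar>))"

end

theory Submission
  imports Defs
begin

text \<open>
  The theorem is Dynkin's formula at the hitting time \<open>T\<close> of \<open>y\<close>: since \<open>L V = - f\<close>, the
  process \<open>V (X t) + \<integral>\<^sub>0\<^sup>t f (X s) ds\<close> is a martingale, and stopping it at \<open>T\<close>, where \<open>V\<close> takes the
  value \<open>V y\<close>, gives \<open>V x - V y\<close> as the expectation of \<open>f\<close> accumulated up to \<open>T\<close>. The estimate
  follows by bounding the accumulated integral by \<open>T\<close> times the maximum of \<open>\<bar>f\<bar>\<close> and exchanging
  \<open>x\<close> and \<open>y\<close>.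

  The process is known only through its finite-dimensional distributions and the right
  continuity of its paths, so optional stopping is carried out by hand. For a cutoff \<open>a > 0\<close>,
  time is discretised with mesh \<open>a / N\<close> and \<open>T\<close> is replaced by the first grid time at which the
  process is seen in \<open>y\<close>. The event that this has not yet happened is a cylinder event of finitely
  many grid times, so on each mesh interval the Markov property and
  Fubini's theorem give the exact increment (\<open>dynkin_step\<close>), and the
  increments telescope (\<open>dynkin_grid\<close>). Only times are discretised, not the integral of
  \<open>L u (X s)\<close>; hence no error term appears. By right continuity the grid hitting times
  approach \<open>min T a\<close> from the right, within one mesh width, and for fine meshes the state there is already the final
  one; bounded convergence gives \<open>dynkin_formula\<close> at the time \<open>min T a\<close>.

  To let \<open>a\<close> tend to infinity one needs \<open>T\<close> to have finite mean. Irreducibility provides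
  a nonnegative function \<open>U\<close> with \<open>L U \<le> - 1\<close> away from \<open>y\<close> (\<open>exists_lyapunov_function\<close>), and
  Dynkin's formula for \<open>U\<close> bounds the mean of \<open>min T a\<close> by \<open>U x\<close>, uniformly in \<open>a\<close>.
  A multiple of \<open>T\<close> then dominates the accumulated integrals of \<open>f\<close>.
\<close>

section \<open>The transition semigroup\<close>

text \<open>The operator \<open>exp (t L)\<close>, as the exponential series evaluated pointwise; its matrix
  entries are the transition probabilities.\<close>

definition transition_semigroup :: "('a::finite \<Rightarrow> 'a \<Rightarrow> real) \<Rightarrow> real \<Rightarrow> ('a \<Rightarrow> real) \<Rightarrow> 'a \<Rightarrow> real" where
  "transition_semigroup k t g x = (\<Sum>n. t ^ n / fact n * ((generator k ^^ n) g) x)"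

text \<open>On a finite state space \<open>L\<close> is a bounded operator for the maximum norm, with norm at most
  twice the sum of all rates. A geometric bound on its powers is what makes the exponential
  series converge for every time.\<close>

lemma generator_power_bound:
  fixes k :: "'a::finite \<Rightarrow> 'a \<Rightarrow> real"
  shows "\<exists>C M. \<forall>n x. \<bar>(generator k ^^ n) g x\<bar> \<le> C ^ n * M"
proof -
  define C where "C = 2 * (\<Sum>x\<in>UNIV. \<Sum>y\<in>UNIV. \<bar>k x y\<bar>)"
  define M where "M = (\<Sum>x\<in>UNIV. \<bar>g x\<bar>)"
  have C: "(\<Sum>y\<in>UNIV. \<bar>k x y\<bar>) * 2 \<le> C" for x
    unfolding C_def using member_le_sum[of x UNIV "\<lambda>x. \<Sum>y\<in>UNIV. \<bar>k x y\<bar>"]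
    by (simp add: sum_nonneg)
  have step: "\<bar>generator k h x\<bar> \<le> C * B" if h: "\<And>x. \<bar>h x\<bar> \<le> B" for h B x
  proof -
    have "0 \<le> B" using h[of x] by linarith
    have "\<bar>generator k h x\<bar> \<le> (\<Sum>y\<in>UNIV. \<bar>k x y * (h y - h x)\<bar>)"
      unfolding generator_def by (rule sum_abs)
    also have "\<dots> \<le> (\<Sum>y\<in>UNIV. \<bar>k x y\<bar> * (2 * B))"
    proof (rule sum_mono)
      fix y
      have "\<bar>h y - h x\<bar> \<le> 2 * B" using h[of x] h[of y] by linarith
      then show "\<bar>k x y * (h y - h x)\<bar> \<le> \<bar>k x y\<bar> * (2 * B)"
        by (simp add: abs_mult mult_left_mono)
    qed
    also have "\<dots> = (\<Sum>y\<in>UNIV. \<bar>k x y\<bar>) * 2 * B"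
      by (simp only: sum_distrib_right[symmetric] mult.assoc)
    also have "\<dots> \<le> C * B" using C[of x] \<open>0 \<le> B\<close> by (rule mult_right_mono)
    finally show ?thesis .
  qed
  have "\<bar>(generator k ^^ n) g x\<bar> \<le> C ^ n * M" for n x
  proof (induction n arbitrary: x)
    case 0
    show ?case unfolding M_def using member_le_sum[of x UNIV "\<lambda>x. \<bar>g x\<bar>"] by simp
  next
    case (Suc n)
    show ?case using step[OF Suc.IH] by (simp add: mult.assoc)
  qed
  then show ?thesis by blast
qed

lemma summable_transition_semigroup:
  "summable (\<lambda>n. t ^ n / fact n * (generator k ^^ n) g x)"
proof -
  obtain C M where CM: "\<And>n x. \<bar>(generator k ^^ n) g x\<bar> \<le> C ^ n * M"
    using generator_power_bound by blast
  have "summable (\<lambda>n. (\<bar>t\<bar> * C) ^ n /\<^sub>R fact n * M)"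
    by (intro summable_mult2 summable_exp_generic)
  then show ?thesis
  proof (rule summable_comparison_test')
    fix n
    have "\<bar>t\<bar> ^ n / fact n * \<bar>(generator k ^^ n) g x\<bar> \<le> \<bar>t\<bar> ^ n / fact n * (C ^ n * M)"
      by (intro mult_left_mono CM) auto
    then show "norm (t ^ n / fact n * (generator k ^^ n) g x) \<le> (\<bar>t\<bar> * C) ^ n /\<^sub>R fact n * M"
      by (simp add: abs_mult power_abs power_mult_distrib field_simps)
  qed
qed

lemma generator_sum:
  "generator k (\<lambda>x. \<Sum>w\<in>A. c w * g w x) x = (\<Sum>w\<in>A. c w * generator k (g w) x)"
proof -
  have "generator k (\<lambda>x. \<Sum>w\<in>A. c w * g w x) x
      = (\<Sum>y\<in>UNIV. \<Sum>w\<in>A. c w * (k x y * (g w y - g w x)))"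
    unfolding generator_def
    by (intro sum.cong) (auto simp: sum_distrib_left sum_subtractf[symmetric] algebra_simps)
  also have "\<dots> = (\<Sum>w\<in>A. c w * generator k (g w) x)"
    unfolding generator_def by (subst sum.swap) (simp add: sum_distrib_left)
  finally show ?thesis .
qed

lemma generator_power_sum:
  "(generator k ^^ n) (\<lambda>x. \<Sum>w\<in>A. c w * g w x) = (\<lambda>x. \<Sum>w\<in>A. c w * (generator k ^^ n) (g w) x)"
  by (induction n) (auto simp: generator_sum)

lemma transition_semigroup_eq_sum_transition_prob:
  "transition_semigroup k t g x = (\<Sum>w\<in>UNIV. transition_prob k t x w * g w)"
proof -
  have g: "g = (\<lambda>x. \<Sum>w\<in>UNIV. g w * indicator {w} x)"
    by (auto simp: indicator_def)
  have "(generator k ^^ n) g x = (\<Sum>w\<in>UNIV. g w * (generator k ^^ n) (indicator {w}) x)" for n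
    by (subst g, subst generator_power_sum) simp
  then have "transition_semigroup k t g x
      = (\<Sum>n. \<Sum>w\<in>UNIV. g w * (t ^ n / fact n * (generator k ^^ n) (indicator {w}) x))"
    unfolding transition_semigroup_def by (simp add: sum_distrib_left algebra_simps)
  also have "\<dots> = (\<Sum>w\<in>UNIV. \<Sum>n. g w * (t ^ n / fact n * (generator k ^^ n) (indicator {w}) x))"
    by (intro suminf_sum summable_mult summable_transition_semigroup)
  also have "\<dots> = (\<Sum>w\<in>UNIV. transition_prob k t x w * g w)"
    unfolding transition_prob_def
    by (intro sum.cong refl) (subst suminf_mult[OF summable_transition_semigroup], simp only: mult.commute)
  finally show ?thesis .
qed

lemma transition_semigroup_0 [simp]: "transition_semigroup k 0 g x = g x"
proof -
  have "(\<lambda>n. 0 ^ n / fact n * (generator k ^^ n) g x) sums (\<Sum>n\<in>{0}. 0 ^ n / fact n * (generator k ^^ n) g x)"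
    by (rule sums_finite) auto
  then show ?thesis unfolding transition_semigroup_def by (simp add: sums_iff)
qed

lemma DERIV_transition_semigroup:
  "((\<lambda>t. transition_semigroup k t g x) has_real_derivative transition_semigroup k t (generator k g) x) (at t)"
proof -
  define c where "c n = (generator k ^^ n) g x / fact n" for n
  have "summable (\<lambda>n. c n * s ^ n)" for s
    using summable_transition_semigroup[of s k g x] by (simp add: c_def mult_ac)
  then have "((\<lambda>t. \<Sum>n. c n * t ^ n) has_real_derivative (\<Sum>n. diffs c n * t ^ n)) (at t)"
    by (rule termdiffs_strong_converges_everywhere)
  moreover have "diffs c n * t ^ n = t ^ n / fact n * (generator k ^^ n) (generator k g) x" for n
    by (simp add: c_def diffs_def funpow_swap1)
  ultimately show ?thesis
    by (simp add: transition_semigroup_def c_def mult_ac)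
qed

lemma DERIV_transition_semigroup_shift:
  "((\<lambda>s. transition_semigroup k (s - a) g x) has_real_derivative
      transition_semigroup k (s - a) (generator k g) x) (at s)"
  using DERIV_transition_semigroup[of k g x "s - a"]
    DERIV_shift[of "\<lambda>t. transition_semigroup k t g x" _ s "- a"] by simp

lemma interval_integral_Ico:
  fixes a b :: real
  assumes "a \<le> b"
  shows "(LBINT s=a..b. g s) = (LBINT s:{a..<b}. g s)"
  using assms by (auto intro!: set_integral_discrete_difference[where X = "{a, b}"]
      simp: interval_lebesgue_integral_def einterval_iff)

text \<open>Kolmogorov's backward equation in integrated form.\<close>

lemma transition_semigroup_integral:
  assumes "a \<le> b"
  shows "(LBINT s:{a..<b}. transition_semigroup k (s - a) (generator k g) x) = transition_semigroup k (b - a) g x - g x"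
proof -
  have "(LBINT s=a..b. transition_semigroup k (s - a) (generator k g) x)
      = transition_semigroup k (b - a) g x - transition_semigroup k (a - a) g x"
  proof (rule interval_integral_FTC_finite)
    show "continuous_on {min a b..max a b} (\<lambda>s. transition_semigroup k (s - a) (generator k g) x)"
      by (intro continuous_at_imp_continuous_on ballI DERIV_isCont[OF DERIV_transition_semigroup_shift])
    show "((\<lambda>s. transition_semigroup k (s - a) g x) has_vector_derivative
        transition_semigroup k (s - a) (generator k g) x) (at s within {min a b..max a b})" for s
      using DERIV_transition_semigroup_shift[of k a g x s] unfolding has_real_derivative_iff_has_vector_derivative
      by (rule has_vector_derivative_at_within)
  qed
  then show ?thesis using assms by (simp add: interval_integral_Ico)
qed

section \<open>A Lyapunov function for hitting a state\<close>

text \<open>The graph distance to \<open>y\<close> does this: the first arc of a shortest path to \<open>y\<close> lowers it.\<close>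

lemma exists_decreasing_distance:
  assumes "irreducible_rates k"
  obtains d :: "'a::finite \<Rightarrow> nat"
  where "\<And>z. z \<noteq> y \<Longrightarrow> \<exists>w. w \<noteq> z \<and> 0 < k z w \<and> d w < d z"
proof -
  define R where "R = {(z, w). z \<noteq> w \<and> 0 < k z w}"
  have R: "(z, y) \<in> R\<^sup>*" for z
  proof -
    have "z \<rightarrow>\<^sup>*\<^bsub>rate_digraph k\<^esub> y"
      using assms by (auto simp: irreducible_rates_def rate_digraph_def strongly_connected_def)
    then have "(z, y) \<in> (arcs_ends (rate_digraph k))\<^sup>*"
      unfolding reachable_def by (rule rtrancl_on_rtranclI)
    moreover have "arcs_ends (rate_digraph k) = R"
      by (auto simp: arcs_ends_def arc_to_ends_def rate_digraph_def R_def)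
    ultimately show ?thesis by simp
  qed
  define d where "d z = (LEAST n. (z, y) \<in> R ^^ n)" for z
  have dR: "(z, y) \<in> R ^^ d z" for z
    unfolding d_def using R[of z] by (auto simp: rtrancl_power intro: LeastI)
  show thesis
  proof
    fix z assume "z \<noteq> y"
    with dR[of z] obtain n where n: "d z = Suc n" by (cases "d z") auto
    with dR[of z] obtain w where w: "(z, w) \<in> R" "(w, y) \<in> R ^^ n"
      by (metis relpow_Suc_E2)
    have "d w \<le> n" unfolding d_def using w(2) by (rule Least_le)
    then show "\<exists>w. w \<noteq> z \<and> 0 < k z w \<and> d w < d z"
      using w(1) n by (auto simp: R_def)
  qed
qed

text \<open>The choice \<open>U z = M (1 - e ^ d z)\<close>, with \<open>d\<close> decreasing along some arc out of every state
  other than \<open>y\<close>, works for small \<open>e\<close>: this arc has rate at least \<open>r\<close> and lowers \<open>U\<close> by at least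
  \<open>M e ^ (d z - 1) (1 - e)\<close>, while an upward jump raises \<open>U\<close> by at most \<open>M e ^ d z\<close>, smaller by a
  factor of about \<open>e\<close>. The constant \<open>M\<close> then scales the resulting negative drift up to size \<open>1\<close>.\<close>

lemma exists_lyapunov_function:
  fixes k :: "'a::finite \<Rightarrow> 'a \<Rightarrow> real"
  assumes nonneg: "\<And>x y. x \<noteq> y \<Longrightarrow> 0 \<le> k x y" and "irreducible_rates k"
  obtains U :: "'a \<Rightarrow> real"
  where "\<And>z. 0 \<le> U z" "\<And>z. z \<noteq> y \<Longrightarrow> generator k U z \<le> -1"
proof -
  obtain d :: "'a \<Rightarrow> nat" where
    d: "\<And>z. z \<noteq> y \<Longrightarrow> \<exists>w. w \<noteq> z \<and> 0 < k z w \<and> d w < d z"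
    using exists_decreasing_distance[OF assms(2)] by metis
  define r where "r = Min (insert 1 {k x z |x z. x \<noteq> z \<and> 0 < k x z})"
  have fin: "finite {k x z |x z. x \<noteq> z \<and> 0 < k x z}"
    by (rule finite_subset[of _ "range (\<lambda>(x, z). k x z)"]) auto
  have r0: "0 < r" unfolding r_def using fin by (subst Min_gr_iff) auto
  have r: "r \<le> k x z" if "x \<noteq> z" "0 < k x z" for x z
    unfolding r_def using fin that by (intro Min_le) auto
  define R where "R = (\<Sum>x\<in>UNIV. \<Sum>y\<in>UNIV. \<bar>k x y\<bar>)"
  have R: "(\<Sum>w\<in>UNIV. \<bar>k z w\<bar>) \<le> R" for z
    unfolding R_def using member_le_sum[of z UNIV "\<lambda>x. \<Sum>y\<in>UNIV. \<bar>k x y\<bar>"]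
    by (simp add: sum_nonneg)
  have R0: "0 \<le> R" unfolding R_def by (intro sum_nonneg) auto
  \<comment> \<open>This \<open>e\<close> solves \<open>e (r + R) = r / 2\<close>, so that half of the downward drift remains.\<close>
  define e where "e = r / (2 * (r + R))"
  have e0: "0 < e" and e1: "e \<le> 1" and eR: "e * R = r * (1 / 2 - e)"
    unfolding e_def using r0 R0 by (auto simp: field_simps)
  define D where "D = Max (range d)"
  have D: "d z \<le> D" for z unfolding D_def by (intro Max_ge) auto
  define M where "M = 2 / (r * e ^ D)"
  have M0: "0 < M" unfolding M_def using r0 e0 by simp
  define U where "U z = M * (1 - e ^ d z)" for z
  have U0: "0 \<le> U z" for z
    unfolding U_def using M0 e0 e1 by (simp add: power_le_one)
  have "generator k U z \<le> -1" if z: "z \<noteq> y" for z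
  proof -
    obtain w n where w: "w \<noteq> z" "0 < k z w" "d w \<le> n" "d z = Suc n"
      using d[OF z] by (metis Suc_le_eq less_imp_Suc_add less_Suc_eq_le le_add1)
    have upper: "U v - U z \<le> M * e ^ d z" for v
      unfolding U_def using M0 e0 by (simp add: algebra_simps)
    have "e ^ n \<le> e ^ d w" using w(3) e0 e1 by (intro power_decreasing) auto
    then have drop: "U w - U z \<le> - (M * e ^ n * (1 - e))"
      unfolding U_def using M0 w(4) by (simp add: algebra_simps)
    have "generator k U z = k z w * (U w - U z) + (\<Sum>v\<in>UNIV - {w}. k z v * (U v - U z))"
      unfolding generator_def by (subst sum.remove[of _ w]) auto
    also have "(\<Sum>v\<in>UNIV - {w}. k z v * (U v - U z)) \<le> (\<Sum>v\<in>UNIV - {w}. \<bar>k z v\<bar> * (M * e ^ d z))"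
    proof (rule sum_mono)
      fix v
      show "k z v * (U v - U z) \<le> \<bar>k z v\<bar> * (M * e ^ d z)"
      proof (cases "v = z")
        case True
        then show ?thesis using M0 e0 by simp
      next
        case False
        then have "0 \<le> k z v" using nonneg by metis
        then show ?thesis using upper[of v] by (simp add: mult_left_mono)
      qed
    qed
    also have "\<dots> \<le> (\<Sum>v\<in>UNIV. \<bar>k z v\<bar> * (M * e ^ d z))"
      using M0 e0 by (intro sum_mono2) auto
    also have "\<dots> \<le> R * (M * e ^ d z)"
      unfolding sum_distrib_right[symmetric] using M0 e0 by (intro mult_right_mono R) auto
    also have "k z w * (U w - U z) \<le> k z w * (- (M * e ^ n * (1 - e)))"
      using w(2) drop by (intro mult_left_mono) auto
    also have "\<dots> \<le> - (r * (M * e ^ n * (1 - e)))"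
      using r[of z w] w M0 e0 e1 by (simp add: mult_right_mono)
    also have "- (r * (M * e ^ n * (1 - e))) + R * (M * e ^ d z) = M * e ^ n * (e * R - r * (1 - e))"
      unfolding w(4) by (simp add: algebra_simps)
    also have "\<dots> = - (e ^ n / e ^ D)"
      unfolding eR M_def using r0 e0 by (simp add: field_simps)
    also have "\<dots> \<le> -1"
    proof -
      have "e ^ D \<le> e ^ n" using D[of z] w(4) e0 e1 by (intro power_decreasing) auto
      then show ?thesis using e0 by simp
    qed
    finally show ?thesis by simp
  qed
  with U0 show thesis by (rule that)
qed

section \<open>Path regularity and the Markov property\<close>

lemma finite_type_bounded:
  fixes u :: "'a::finite \<Rightarrow> real"
  obtains C where "0 \<le> C" "\<And>z. \<bar>u z\<bar> \<le> C"
proof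
  show "\<bar>u z\<bar> \<le> (\<Sum>z\<in>UNIV. \<bar>u z\<bar>)" for z
    using member_le_sum[of z UNIV "\<lambda>z. \<bar>u z\<bar>"] by simp
qed (simp add: sum_nonneg)

lemma integrable_indicator_Ico:
  fixes a b C :: real
  shows "integrable lborel (\<lambda>s. C * indicator {a..<b} s)"
proof (intro integrable_mult_right integrable_real_indicator)
  show "emeasure lborel {a..<b} < \<infinity>"
    by (cases "a \<le> b") simp_all
qed simp

context markov_jump_process
begin

interpretation P: prob_space "P x" for x
  by (rule prob_space_P)

lemma sets_X: "0 \<le> t \<Longrightarrow> {\<omega> \<in> space (P x). X t \<omega> \<in> B} \<in> sets (P x)"
  by (rule measurable_sets_Collect[OF measurable_X]) auto

lemma measurable_comp_X: "0 \<le> t \<Longrightarrow> (\<lambda>\<omega>. g (X t \<omega>)) \<in> P x \<rightarrow>\<^sub>M borel"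
  by (rule measurable_compose[OF measurable_X]) auto

lemma right_constant:
  assumes "\<omega> \<in> space (P x)" "0 \<le> s"
  obtains b where "s < b" "\<And>r. s \<le> r \<Longrightarrow> r < b \<Longrightarrow> X r \<omega> = X s \<omega>"
proof -
  obtain b where b: "s < b" "\<And>r. s < r \<Longrightarrow> r < b \<Longrightarrow> X r \<omega> = X s \<omega>"
    using right_continuous_X[OF assms] unfolding eventually_at_right_field by blast
  have "X r \<omega> = X s \<omega>" if "s \<le> r" "r < b" for r
    using b(2)[of r] that by (cases "s = r") auto
  with b(1) show thesis by (rule that)
qed

lemma eventually_X_right:
  assumes "\<omega> \<in> space (P x)" "0 \<le> s" "t \<longlonglongrightarrow> s" "\<And>n. s \<le> t n"
  shows "\<forall>\<^sub>F n in sequentially. X (t n) \<omega> = X s \<omega>"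
proof -
  obtain b where b: "s < b" "\<And>r. s \<le> r \<Longrightarrow> r < b \<Longrightarrow> X r \<omega> = X s \<omega>"
    using right_constant[OF assms(1,2)] by metis
  show ?thesis
    using order_tendstoD(2)[OF assms(3) b(1)] by (rule eventually_mono) (rule b(2)[OF assms(4)])
qed

text \<open>Joint measurability in time and path. The approximating times lie to the right of \<open>s\<close> and tend
  to it, so by right continuity the state at these times is eventually the state at \<open>s\<close>; for each
  approximation only countably many times occur. Negative times, at which \<open>X\<close> is arbitrary, are
  replaced by \<open>0\<close>.\<close>

lemma measurable_pair_X [measurable]:
  fixes g :: "'a \<Rightarrow> real"
  shows "(\<lambda>p. g (X (max 0 (snd p)) (fst p))) \<in> borel_measurable (P x \<Otimes>\<^sub>M lborel)"
proof -
  define j where "j n s = nat \<lfloor>real (Suc n) * max 0 s\<rfloor>" for n s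
  define T where "T n s = real (Suc (j n s)) / real (Suc n)" for n s
  show ?thesis
  proof (rule borel_measurable_LIMSEQ_real[where u = "\<lambda>n p. g (X (T n (snd p)) (fst p))"])
    show "(\<lambda>p. g (X (T n (snd p)) (fst p))) \<in> borel_measurable (P x \<Otimes>\<^sub>M lborel)" for n
    proof -
      have "(\<lambda>p. (\<lambda>i q. g (X (real (Suc i) / real (Suc n)) (fst q))) (j n (snd p)) p)
          \<in> borel_measurable (P x \<Otimes>\<^sub>M lborel)"
      proof (rule measurable_compose_countable[where g = "\<lambda>p. j n (snd p)" and
            f = "\<lambda>i q. g (X (real (Suc i) / real (Suc n)) (fst q))"])
        show "(\<lambda>q. g (X (real (Suc i) / real (Suc n)) (fst q))) \<in> borel_measurable (P x \<Otimes>\<^sub>M lborel)" for i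
          by (rule measurable_compose[OF measurable_fst measurable_comp_X]) simp
        show "(\<lambda>p. j n (snd p)) \<in> (P x \<Otimes>\<^sub>M lborel) \<rightarrow>\<^sub>M count_space UNIV"
          unfolding j_def by measurable
      qed
      then show ?thesis by (simp only: T_def)
    qed
    fix p :: "'w \<times> real" assume "p \<in> space (P x \<Otimes>\<^sub>M lborel)"
    then have "fst p \<in> space (P x)" by (auto simp: space_pair_measure)
    define s where "s = max 0 (snd p)"
    have "0 \<le> s" by (simp add: s_def)
    have T: "s \<le> T n (snd p)" "T n (snd p) \<le> s + 1 / real (Suc n)" for n
    proof -
      have "0 \<le> real (Suc n) * s" using \<open>0 \<le> s\<close> by simp
      then have j_real: "real (j n (snd p)) = of_int \<lfloor>real (Suc n) * s\<rfloor>"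
        unfolding j_def s_def[symmetric] by simp
      have f: "real (j n (snd p)) \<le> real (Suc n) * s" "real (Suc n) * s \<le> real (j n (snd p)) + 1"
        unfolding j_real by linarith+
      have T_eq: "T n (snd p) = (real (j n (snd p)) + 1) / real (Suc n)"
        by (simp add: T_def)
      have "0 < real (Suc n)" by simp
      then show "s \<le> T n (snd p)" "T n (snd p) \<le> s + 1 / real (Suc n)"
        unfolding T_eq using f by (simp_all add: field_simps del: of_nat_Suc)
    qed
    have "(\<lambda>n. s + 1 / real (Suc n)) \<longlonglongrightarrow> s + 0"
      by (intro tendsto_intros LIMSEQ_Suc lim_1_over_n)
    then have upper: "(\<lambda>n. s + 1 / real (Suc n)) \<longlonglongrightarrow> s" by simp
    have "(\<lambda>n. T n (snd p)) \<longlonglongrightarrow> s"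
      by (rule tendsto_sandwich[OF always_eventually[OF allI] always_eventually[OF allI] tendsto_const upper])
        (rule T)+
    then have "\<forall>\<^sub>F n in sequentially. X (T n (snd p)) (fst p) = X s (fst p)"
      by (rule eventually_X_right[OF \<open>fst p \<in> space (P x)\<close> \<open>0 \<le> s\<close> _ T(1)])
    then have "\<forall>\<^sub>F n in sequentially. g (X (T n (snd p)) (fst p)) = g (X s (fst p))"
      by (rule eventually_mono) simp
    then show "(\<lambda>n. g (X (T n (snd p)) (fst p))) \<longlonglongrightarrow> g (X (max 0 (snd p)) (fst p))"
      unfolding s_def by (rule tendsto_eventually)
  qed
qed

lemma measurable_path:
  fixes g :: "'a \<Rightarrow> real"
  assumes "\<omega> \<in> space (P x)"
  shows "(\<lambda>s. g (X (max 0 s) \<omega>)) \<in> borel_measurable lborel"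
  using measurable_compose[OF measurable_Pair1'[OF assms, of lborel] measurable_pair_X[of g x]]
  by (simp only: fst_conv snd_conv)

lemma X_0: "AE \<omega> in P x. X 0 \<omega> = x"
proof -
  have "measure (P x) {\<omega> \<in> space (P x). X 0 \<omega> = x} = 1"
    using finite_dim_distributions[of "\<lambda>_. 0" "\<lambda>_. x" x 0] by simp
  then have "AE \<omega> in P x. \<omega> \<in> {\<omega> \<in> space (P x). X 0 \<omega> = x}"
    by (rule P.AE_prob_1)
  then show ?thesis by (rule eventually_mono) simp
qed

text \<open>Conditioning on a single path along finitely many times: comparing the finite-dimensional
  distribution for \<open>n + 1\<close> steps with that for \<open>n\<close> steps isolates the last factor of the product.
  A path not starting at \<open>x\<close> has probability \<open>0\<close> on both sides.\<close>

lemma markov_path: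
  assumes t: "t 0 = 0" "\<And>i. i < n \<Longrightarrow> t i \<le> t (Suc i)" "0 \<le> s"
  shows "measure (P x) {\<omega> \<in> space (P x). (\<forall>i\<le>n. X (t i) \<omega> = z i) \<and> X (t n + s) \<omega> = w}
    = measure (P x) {\<omega> \<in> space (P x). \<forall>i\<le>n. X (t i) \<omega> = z i} * transition_prob k s (z n) w"
proof (cases "z 0 = x")
  case True
  define t' z' where "t' = t(Suc n := t n + s)" and "z' = z(Suc n := w)"
  have "{\<omega> \<in> space (P x). (\<forall>i\<le>n. X (t i) \<omega> = z i) \<and> X (t n + s) \<omega> = w}
      = {\<omega> \<in> space (P x). \<forall>i\<le>Suc n. X (t' i) \<omega> = z' i}"
    by (auto simp: t'_def z'_def le_Suc_eq)
  also have "measure (P x) \<dots>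
      = (\<Prod>i<Suc n. transition_prob k (t' (Suc i) - t' i) (z' i) (z' (Suc i)))"
    using t True by (intro finite_dim_distributions) (auto simp: t'_def z'_def less_Suc_eq)
  also have "\<dots> = (\<Prod>i<n. transition_prob k (t (Suc i) - t i) (z i) (z (Suc i)))
      * transition_prob k s (z n) w"
    by (auto simp: t'_def z'_def intro!: prod.cong)
  also have "(\<Prod>i<n. transition_prob k (t (Suc i) - t i) (z i) (z (Suc i)))
      = measure (P x) {\<omega> \<in> space (P x). \<forall>i\<le>n. X (t i) \<omega> = z i}"
    using t True by (intro finite_dim_distributions[symmetric]) auto
  finally show ?thesis .
next
  case False
  have z0: "measure (P x) {\<omega> \<in> space (P x). X 0 \<omega> \<in> - {x}} = 0"
    using eventually_mono[OF X_0[of x]] sets_X[of 0 x "- {x}"] by (subst P.prob_eq_0) simp_all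
  have "measure (P x) {\<omega> \<in> space (P x). (\<forall>i\<le>n. X (t i) \<omega> = z i) \<and> Q \<omega>}
      \<le> measure (P x) {\<omega> \<in> space (P x). X 0 \<omega> \<in> - {x}}" for Q
  proof (rule P.finite_measure_mono)
    show "{\<omega> \<in> space (P x). (\<forall>i\<le>n. X (t i) \<omega> = z i) \<and> Q \<omega>} \<subseteq> {\<omega> \<in> space (P x). X 0 \<omega> \<in> - {x}}"
    proof
      fix \<omega> assume "\<omega> \<in> {\<omega> \<in> space (P x). (\<forall>i\<le>n. X (t i) \<omega> = z i) \<and> Q \<omega>}"
      then have "\<omega> \<in> space (P x)" "X (t 0) \<omega> = z 0" by blast+
      then show "\<omega> \<in> {\<omega> \<in> space (P x). X 0 \<omega> \<in> - {x}}" using False t(1) by simp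
    qed
    show "{\<omega> \<in> space (P x). X 0 \<omega> \<in> - {x}} \<in> sets (P x)"
      by (rule sets_X) simp
  qed
  then have null: "measure (P x) {\<omega> \<in> space (P x). (\<forall>i\<le>n. X (t i) \<omega> = z i) \<and> Q \<omega>} = 0" for Q
    unfolding z0 measure_le_0_iff .
  show ?thesis using null[of "\<lambda>\<omega>. X (t n + s) \<omega> = w"] null[of "\<lambda>_. True"] by simp
qed

lemma times_nonneg:
  fixes t :: "nat \<Rightarrow> real"
  assumes "t 0 = 0" "\<And>i. i < n \<Longrightarrow> t i \<le> t (Suc i)" "i \<le> n"
  shows "0 \<le> t i"
  using assms(3)
proof (induction i)
  case (Suc i)
  then show ?case using assms(2)[of i] by simp
qed (simp add: assms(1))

definition cylinder :: "'a \<Rightarrow> (nat \<Rightarrow> real) \<Rightarrow> (nat \<Rightarrow> 'a set) \<Rightarrow> nat \<Rightarrow> 'w set" where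
  "cylinder x t B n = {\<omega> \<in> space (P x). \<forall>i\<le>n. X (t i) \<omega> \<in> B i}"

lemma sets_cylinder:
  assumes "\<And>i. i \<le> n \<Longrightarrow> 0 \<le> t i"
  shows "cylinder x t B n \<in> sets (P x)"
proof -
  have "cylinder x t B n = (\<Inter>i\<in>{..n}. {\<omega> \<in> space (P x). X (t i) \<omega> \<in> B i})"
    unfolding cylinder_def by auto
  also have "\<dots> \<in> sets (P x)"
    by (intro sets.finite_INT sets_X assms) simp_all
  finally show ?thesis .
qed

text \<open>A cylinder event is a finite disjoint union of events that fix the whole path along the
  given times, so the statement for paths can be summed.\<close>

lemma markov_property:
  assumes t: "t 0 = 0" "\<And>i. i < n \<Longrightarrow> t i \<le> t (Suc i)" "0 \<le> s"
  shows "measure (P x) {\<omega> \<in> cylinder x t B n. X (t n) \<omega> = z \<and> X (t n + s) \<omega> = w}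
    = measure (P x) {\<omega> \<in> cylinder x t B n. X (t n) \<omega> = z} * transition_prob k s z w"
proof -
  have nonneg: "0 \<le> t i" if "i \<le> n" for i
    using t(1,2) that by (rule times_nonneg)
  define Z where "Z = {\<zeta> \<in> PiE {..n} B. \<zeta> n = z}"
  have "finite Z" unfolding Z_def by (simp add: finite_PiE)
  have path: "measure (P x) {\<omega> \<in> cylinder x t B n. X (t n) \<omega> = z \<and> X (t n + r) \<omega> \<in> C}
    = (\<Sum>\<zeta>\<in>Z. measure (P x) {\<omega> \<in> space (P x). (\<forall>i\<le>n. X (t i) \<omega> = \<zeta> i) \<and> X (t n + r) \<omega> \<in> C})"
    if "0 \<le> r" for r C
  proof -
    let ?A = "\<lambda>\<zeta>. {\<omega> \<in> space (P x). (\<forall>i\<le>n. X (t i) \<omega> = \<zeta> i) \<and> X (t n + r) \<omega> \<in> C}"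
    have union: "{\<omega> \<in> cylinder x t B n. X (t n) \<omega> = z \<and> X (t n + r) \<omega> \<in> C} = (\<Union>\<zeta>\<in>Z. ?A \<zeta>)"
    proof (intro equalityI subsetI)
      fix \<omega> assume "\<omega> \<in> {\<omega> \<in> cylinder x t B n. X (t n) \<omega> = z \<and> X (t n + r) \<omega> \<in> C}"
      then have "restrict (\<lambda>i. X (t i) \<omega>) {..n} \<in> Z" "\<omega> \<in> ?A (restrict (\<lambda>i. X (t i) \<omega>) {..n})"
        by (auto simp: Z_def cylinder_def)
      then show "\<omega> \<in> (\<Union>\<zeta>\<in>Z. ?A \<zeta>)" by blast
    qed (auto simp: Z_def cylinder_def PiE_iff)
    have events: "?A \<zeta> \<in> sets (P x)" for \<zeta>
    proof -
      have "?A \<zeta> = cylinder x t (\<lambda>i. {\<zeta> i}) n \<inter> {\<omega> \<in> space (P x). X (t n + r) \<omega> \<in> C}"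
        by (auto simp: cylinder_def)
      also have "\<dots> \<in> sets (P x)"
        using nonneg \<open>0 \<le> r\<close> by (intro sets.Int sets_cylinder sets_X) auto
      finally show ?thesis .
    qed
    have disj: "disjoint_family_on ?A Z"
      unfolding disjoint_family_on_def
    proof (intro ballI impI)
      fix \<zeta> \<xi> assume *: "\<zeta> \<in> Z" "\<xi> \<in> Z" "\<zeta> \<noteq> \<xi>"
      then have "\<exists>i\<le>n. \<zeta> i \<noteq> \<xi> i" by (metis (no_types, lifting) PiE_ext Z_def atMost_iff mem_Collect_eq)
      then show "?A \<zeta> \<inter> ?A \<xi> = {}" by force
    qed
    show ?thesis unfolding union
      by (rule P.finite_measure_finite_Union) (use \<open>finite Z\<close> events disj in blast)+
  qed
  have "measure (P x) {\<omega> \<in> cylinder x t B n. X (t n) \<omega> = z \<and> X (t n + s) \<omega> = w}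
      = (\<Sum>\<zeta>\<in>Z. measure (P x) {\<omega> \<in> space (P x). \<forall>i\<le>n. X (t i) \<omega> = \<zeta> i} * transition_prob k s z w)"
    unfolding path[OF t(3), of "{w}", unfolded singleton_iff]
  proof (rule sum.cong[OF refl])
    fix \<zeta> assume "\<zeta> \<in> Z"
    then have "\<zeta> n = z" by (simp add: Z_def)
    then show "measure (P x) {\<omega> \<in> space (P x). (\<forall>i\<le>n. X (t i) \<omega> = \<zeta> i) \<and> X (t n + s) \<omega> = w}
        = measure (P x) {\<omega> \<in> space (P x). \<forall>i\<le>n. X (t i) \<omega> = \<zeta> i} * transition_prob k s z w"
      by (simp only: markov_path[OF t])
  qed
  also have "\<dots> = measure (P x) {\<omega> \<in> cylinder x t B n. X (t n) \<omega> = z} * transition_prob k s z w"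
    using path[of 0 UNIV] by (simp only: sum_distrib_right[symmetric] UNIV_I simp_thms order_refl)
  finally show ?thesis .
qed

lemma markov_property_expectation:
  fixes g :: "'a \<Rightarrow> real"
  assumes t: "t 0 = 0" "\<And>i. i < n \<Longrightarrow> t i \<le> t (Suc i)" "0 \<le> s"
  shows "(\<integral>\<omega>. indicator (cylinder x t B n) \<omega> * g (X (t n + s) \<omega>) \<partial>P x)
    = (\<Sum>z\<in>UNIV. measure (P x) {\<omega> \<in> cylinder x t B n. X (t n) \<omega> = z} * transition_semigroup k s g z)"
proof -
  have nonneg: "0 \<le> t i" if "i \<le> n" for i
    using t(1,2) that by (rule times_nonneg)
  let ?A = "\<lambda>z w. {\<omega> \<in> cylinder x t B n. X (t n) \<omega> = z \<and> X (t n + s) \<omega> = w}"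
  have A [measurable]: "?A z w \<in> sets (P x)" for z w
  proof -
    have "?A z w = cylinder x t B n \<inter> {\<omega> \<in> space (P x). X (t n) \<omega> \<in> {z}}
        \<inter> {\<omega> \<in> space (P x). X (t n + s) \<omega> \<in> {w}}"
      by (auto simp: cylinder_def)
    also have "\<dots> \<in> sets (P x)"
      using nonneg t(3) by (intro sets.Int sets_cylinder sets_X) auto
    finally show ?thesis .
  qed
  have "indicator (cylinder x t B n) \<omega> * g (X (t n + s) \<omega>)
      = (\<Sum>z\<in>UNIV. \<Sum>w\<in>UNIV. g w * indicator (?A z w) \<omega>)" for \<omega>
  proof -
    have "(\<Sum>z\<in>UNIV. \<Sum>w\<in>UNIV. g w * indicator (?A z w) \<omega>)
        = (\<Sum>z\<in>UNIV. \<Sum>w\<in>UNIV. if w = X (t n + s) \<omega> then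
            (if z = X (t n) \<omega> then g w * indicator (cylinder x t B n) \<omega> else 0) else 0)"
      by (intro sum.cong refl) (auto simp: indicator_def)
    then show ?thesis by simp
  qed
  then have "(\<integral>\<omega>. indicator (cylinder x t B n) \<omega> * g (X (t n + s) \<omega>) \<partial>P x)
      = (\<integral>\<omega>. (\<Sum>z\<in>UNIV. \<Sum>w\<in>UNIV. g w * indicator (?A z w) \<omega>) \<partial>P x)"
    by (intro Bochner_Integration.integral_cong refl)
  also have "\<dots> = (\<Sum>z\<in>UNIV. \<Sum>w\<in>UNIV. \<integral>\<omega>. g w * indicator (?A z w) \<omega> \<partial>P x)"
  proof -
    have "integrable (P x) (\<lambda>\<omega>. g w * indicator (?A z w) \<omega>)" for z w
      using A by (intro integrable_mult_right integrable_real_indicator) (simp_all add: P.emeasure_eq_measure)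
    note int = this
    have "(\<integral>\<omega>. (\<Sum>z\<in>UNIV. \<Sum>w\<in>UNIV. g w * indicator (?A z w) \<omega>) \<partial>P x)
        = (\<Sum>z\<in>UNIV. \<integral>\<omega>. (\<Sum>w\<in>UNIV. g w * indicator (?A z w) \<omega>) \<partial>P x)"
      by (rule Bochner_Integration.integral_sum) (rule Bochner_Integration.integrable_sum, rule int)
    also have "\<dots> = (\<Sum>z\<in>UNIV. \<Sum>w\<in>UNIV. \<integral>\<omega>. g w * indicator (?A z w) \<omega> \<partial>P x)"
      by (rule sum.cong[OF refl]) (rule Bochner_Integration.integral_sum, rule int)
    finally show ?thesis .
  qed
  also have "\<dots> = (\<Sum>z\<in>UNIV. \<Sum>w\<in>UNIV. g w * measure (P x) (?A z w))"
  proof (intro sum.cong refl)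
    fix z w
    have "?A z w \<inter> space (P x) = ?A z w" using sets.sets_into_space[OF A] by (rule Int_absorb2)
    then show "(\<integral>\<omega>. g w * indicator (?A z w) \<omega> \<partial>P x) = g w * measure (P x) (?A z w)" by simp
  qed
  also have "\<dots> = (\<Sum>z\<in>UNIV. \<Sum>w\<in>UNIV. g w *
      (measure (P x) {\<omega> \<in> cylinder x t B n. X (t n) \<omega> = z} * transition_prob k s z w))"
    by (simp only: markov_property[OF t])
  also have "\<dots> = (\<Sum>z\<in>UNIV. measure (P x) {\<omega> \<in> cylinder x t B n. X (t n) \<omega> = z} * transition_semigroup k s g z)"
    unfolding transition_semigroup_eq_sum_transition_prob sum_distrib_left
    by (intro sum.cong refl) (simp only: ac_simps)
  finally show ?thesis .
qed

text \<open>The martingale property of \<open>u (X t) - \<integral>\<^sub>0\<^sup>t L u (X s) ds\<close>, tested against a cylinder event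
  observed up to \<open>t n\<close>. Conditionally on the state \<open>z\<close> at \<open>t n\<close> both sides are the integrated
  backward equation started in \<open>z\<close>; Fubini's theorem moves the expectation inside the time
  integral.\<close>

lemma dynkin_step:
  fixes u :: "'a \<Rightarrow> real" and x :: 'a and B :: "nat \<Rightarrow> 'a set"
  assumes t: "t 0 = 0" "\<And>i. i < n \<Longrightarrow> t i \<le> t (Suc i)" "t n \<le> r"
  defines "D \<equiv> cylinder x t B n"
  shows "(\<integral>\<omega>. indicator D \<omega> * (u (X r \<omega>) - u (X (t n) \<omega>)) \<partial>P x)
    = (\<integral>\<omega>. indicator D \<omega> * (LBINT s:{t n..<r}. generator k u (X s \<omega>)) \<partial>P x)"
proof -
  have nonneg: "0 \<le> t i" if "i \<le> n" for i
    using t(1,2) that by (rule times_nonneg)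
  have D [measurable]: "D \<in> sets (P x)"
    unfolding D_def by (intro sets_cylinder nonneg)
  have pair: "pair_sigma_finite (P x) (lborel :: real measure)"
    by (intro pair_sigma_finite.intro P.sigma_finite_measure_axioms lborel.sigma_finite_measure_axioms)
  let ?m = "\<lambda>z. measure (P x) {\<omega> \<in> D. X (t n) \<omega> = z}"
  have markov: "(\<integral>\<omega>. indicator D \<omega> * g (X (t n + s) \<omega>) \<partial>P x)
      = (\<Sum>z\<in>UNIV. ?m z * transition_semigroup k s g z)" if "0 \<le> s" for s and g :: "'a \<Rightarrow> real"
    unfolding D_def by (rule markov_property_expectation[OF t(1,2) that])
  let ?L = "generator k u"
  obtain C where C: "0 \<le> C" "\<And>z. \<bar>?L z\<bar> \<le> C"
    using finite_type_bounded[of ?L] by metis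
  obtain C' where C': "0 \<le> C'" "\<And>z. \<bar>u z\<bar> \<le> C'"
    using finite_type_bounded[of u] by metis
  have int: "integrable (P x) (\<lambda>\<omega>. indicator D \<omega> * u (X s \<omega>))" if "0 \<le> s" for s
  proof (rule P.integrable_const_bound)
    show "AE \<omega> in P x. norm (indicator D \<omega> * u (X s \<omega>)) \<le> C'"
      using C' by (intro AE_I2) (simp add: indicator_def)
    show "(\<lambda>\<omega>. indicator D \<omega> * u (X s \<omega>)) \<in> borel_measurable (P x)"
      using D by (intro borel_measurable_times borel_measurable_indicator measurable_comp_X that)
  qed
  define F where "F \<omega> s = indicator D \<omega> * (indicator {t n..<r} s * ?L (X (max 0 s) \<omega>))" for \<omega> and s :: real
  have F: "integrable (P x \<Otimes>\<^sub>M lborel) (case_prod F)"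
  proof (rule Bochner_Integration.integrable_bound)
    have "emeasure (P x \<Otimes>\<^sub>M lborel) (space (P x) \<times> {t n..<r}) < \<infinity>"
      using t(3) by (simp add: lborel.emeasure_pair_measure_Times P.emeasure_space_1)
    then show "integrable (P x \<Otimes>\<^sub>M lborel) (\<lambda>p. C * indicator (space (P x) \<times> {t n..<r}) p)"
      by (intro integrable_mult_right integrable_real_indicator pair_measureI) auto
    show "case_prod F \<in> borel_measurable (P x \<Otimes>\<^sub>M lborel)"
      unfolding F_def case_prod_beta by measurable
    show "AE p in P x \<Otimes>\<^sub>M lborel. norm (case_prod F p)
        \<le> norm (C * indicator (space (P x) \<times> {t n..<r}) p)"
    proof (intro AE_I2)
      fix p :: "'w \<times> real" assume "p \<in> space (P x \<Otimes>\<^sub>M lborel)"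
      then have "fst p \<in> space (P x)" by (simp add: space_pair_measure mem_Times_iff)
      then show "norm (case_prod F p) \<le> norm (C * indicator (space (P x) \<times> {t n..<r}) p)"
        using C by (simp add: F_def case_prod_beta indicator_def mem_Times_iff)
    qed
  qed
  have "0 \<le> t n" by (rule nonneg[OF order_refl])
  with t(3) have "0 \<le> r" by simp
  have "(\<integral>\<omega>. indicator D \<omega> * (u (X r \<omega>) - u (X (t n) \<omega>)) \<partial>P x)
      = (\<integral>\<omega>. indicator D \<omega> * u (X (t n + (r - t n)) \<omega>) \<partial>P x)
        - (\<integral>\<omega>. indicator D \<omega> * u (X (t n + 0) \<omega>) \<partial>P x)"
    using Bochner_Integration.integral_diff[OF int[OF \<open>0 \<le> r\<close>] int[OF \<open>0 \<le> t n\<close>]]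
    by (simp only: right_diff_distrib add_diff_cancel_left' le_add_diff_inverse add_0_right t(3))
  also have "\<dots> = (\<Sum>z\<in>UNIV. ?m z * (transition_semigroup k (r - t n) u z - u z))"
  proof -
    have "0 \<le> r - t n" using t(3) by simp
    then show ?thesis
      unfolding markov[OF \<open>0 \<le> r - t n\<close>] markov[OF order_refl] transition_semigroup_0
      by (simp only: right_diff_distrib sum_subtractf)
  qed
  also have "\<dots> = (\<Sum>z\<in>UNIV. ?m z * (LBINT s:{t n..<r}. transition_semigroup k (s - t n) ?L z))"
    by (simp only: transition_semigroup_integral[OF t(3)])
  also have "\<dots> = (\<Sum>z\<in>UNIV. (\<integral>s. ?m z * (indicator {t n..<r} s * transition_semigroup k (s - t n) ?L z) \<partial>lborel))"
    by (simp add: set_lebesgue_integral_def)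
  also have "\<dots> = (\<integral>s. (\<Sum>z\<in>UNIV. ?m z * (indicator {t n..<r} s * transition_semigroup k (s - t n) ?L z)) \<partial>lborel)"
  proof (rule Bochner_Integration.integral_sum[symmetric])
    fix z
    have "continuous_on {t n..r} (\<lambda>s. transition_semigroup k (s - t n) ?L z)"
      by (intro continuous_at_imp_continuous_on ballI
          DERIV_isCont[OF DERIV_transition_semigroup_shift])
    then have "set_integrable lborel {t n..r} (\<lambda>s. transition_semigroup k (s - t n) ?L z)"
      by (rule borel_integrable_atLeastAtMost')
    then have "set_integrable lborel {t n..<r} (\<lambda>s. transition_semigroup k (s - t n) ?L z)"
      by (rule set_integrable_subset) auto
    then show "integrable lborel (\<lambda>s. ?m z * (indicator {t n..<r} s * transition_semigroup k (s - t n) ?L z))"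
      by (intro integrable_mult_right) (simp only: set_integrable_def real_scaleR_def)
  qed
  also have "\<dots> = (\<integral>s. (\<integral>\<omega>. F \<omega> s \<partial>P x) \<partial>lborel)"
  proof (rule Bochner_Integration.integral_cong[OF refl])
    fix s
    show "(\<Sum>z\<in>UNIV. ?m z * (indicator {t n..<r} s * transition_semigroup k (s - t n) ?L z)) = (\<integral>\<omega>. F \<omega> s \<partial>P x)"
    proof (cases "s \<in> {t n..<r}")
      case True
      then have "0 \<le> s - t n" "max 0 s = t n + (s - t n)" using \<open>0 \<le> t n\<close> by auto
      then show ?thesis
        using True markov[of "s - t n" ?L] by (simp only: F_def indicator_simps mult_1)
    qed (simp add: F_def)
  qed
  also have "\<dots> = (\<integral>\<omega>. (\<integral>s. F \<omega> s \<partial>lborel) \<partial>P x)"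
    using F by (rule pair_sigma_finite.Fubini_integral[OF pair])
  also have "\<dots> = (\<integral>\<omega>. indicator D \<omega> * (LBINT s:{t n..<r}. ?L (X s \<omega>)) \<partial>P x)"
  proof (rule Bochner_Integration.integral_cong[OF refl])
    fix \<omega>
    have eq: "indicator {t n..<r} s * ?L (X (max 0 s) \<omega>) = indicator {t n..<r} s * ?L (X s \<omega>)" for s
      using \<open>0 \<le> t n\<close> by (simp add: indicator_def)
    show "(\<integral>s. F \<omega> s \<partial>lborel) = indicator D \<omega> * (LBINT s:{t n..<r}. ?L (X s \<omega>))"
      unfolding F_def set_lebesgue_integral_def real_scaleR_def eq by (rule integral_mult_right_zero)
  qed
  finally show ?thesis .
qed

section \<open>Escape times and integrals along paths\<close>

lemma escape_time_nonneg: "0 \<le> escape_time X H \<omega>"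
  unfolding escape_time_def by (rule Inf_greatest) auto

lemma before_escape_time:
  assumes "0 \<le> s" "ereal s < escape_time X (UNIV - {y}) \<omega>"
  shows "X s \<omega> \<noteq> y"
proof
  assume "X s \<omega> = y"
  then have "escape_time X (UNIV - {y}) \<omega> \<le> ereal s"
    unfolding escape_time_def using assms(1) by (intro Inf_lower) auto
  with assms(2) show False by simp
qed

lemma escape_time_less_iff:
  "escape_time X (UNIV - {y}) \<omega> < c \<longleftrightarrow> (\<exists>s\<ge>0. ereal s < c \<and> X s \<omega> = y)"
  unfolding escape_time_def Inf_less_iff by auto

text \<open>The infimum is attained: visits to \<open>y\<close> occur at \<open>r\<close> or arbitrarily soon after it, and the path is constant on a short interval to the right of \<open>r\<close>.\<close>

lemma X_escape_time:
  assumes "\<omega> \<in> space (P x)" and r: "escape_time X (UNIV - {y}) \<omega> = ereal r"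
  shows "X r \<omega> = y"
proof -
  have "0 \<le> r" using escape_time_nonneg[of "UNIV - {y}" \<omega>] r by simp
  obtain b where b: "r < b" "\<And>s. r \<le> s \<Longrightarrow> s < b \<Longrightarrow> X s \<omega> = X r \<omega>"
    using right_constant[OF assms(1) \<open>0 \<le> r\<close>] by metis
  have "escape_time X (UNIV - {y}) \<omega> < ereal b" using r b(1) by simp
  then obtain s where s: "0 \<le> s" "s < b" "X s \<omega> = y"
    unfolding escape_time_less_iff by auto
  have "r \<le> s" using before_escape_time[OF s(1), of y \<omega>] s(3) r by force
  then show ?thesis using b(2)[of s] s by simp
qed

text \<open>Every visit to \<open>y\<close> lasts for a positive time by right continuity, so a visit before \<open>c\<close> is
  seen at some rational time before \<open>c\<close>.\<close>

lemma borel_measurable_escape_time: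
  "escape_time X (UNIV - {y}) \<in> borel_measurable (P x)"
proof (rule borel_measurableI_less)
  fix c :: ereal
  let ?Q = "{q \<in> \<rat>. 0 \<le> q \<and> ereal q < c}"
  have "{\<omega> \<in> space (P x). escape_time X (UNIV - {y}) \<omega> < c}
      = (\<Union>q\<in>?Q. {\<omega> \<in> space (P x). X q \<omega> \<in> {y}})"
  proof (intro equalityI subsetI)
    fix \<omega> assume "\<omega> \<in> {\<omega> \<in> space (P x). escape_time X (UNIV - {y}) \<omega> < c}"
    then have \<omega>: "\<omega> \<in> space (P x)" and "escape_time X (UNIV - {y}) \<omega> < c" by auto
    then obtain s where s: "0 \<le> s" "ereal s < c" "X s \<omega> = y"
      unfolding escape_time_less_iff by blast
    obtain b where b: "s < b" "\<And>r. s \<le> r \<Longrightarrow> r < b \<Longrightarrow> X r \<omega> = X s \<omega>"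
      using right_constant[OF \<omega> s(1)] by metis
    obtain e where e: "s < e" "ereal e < c"
      using ereal_dense2[OF s(2)] by auto
    obtain q where q: "q \<in> \<rat>" "s < q" "q < min b e"
      using Rats_dense_in_real[of s "min b e"] b(1) e(1) by auto
    have "ereal q < c" using q(3) e(2) by (metis ereal_less_le less_imp_le min_less_iff_conj order_less_trans less_ereal.simps(1))
    then have "q \<in> ?Q" using q s(1) by simp
    moreover have "X q \<omega> = y" using b(2)[of q] q s(3) by simp
    ultimately show "\<omega> \<in> (\<Union>q\<in>?Q. {\<omega> \<in> space (P x). X q \<omega> \<in> {y}})"
      using \<omega> by blast
  next
    fix \<omega> assume "\<omega> \<in> (\<Union>q\<in>?Q. {\<omega> \<in> space (P x). X q \<omega> \<in> {y}})"
    then show "\<omega> \<in> {\<omega> \<in> space (P x). escape_time X (UNIV - {y}) \<omega> < c}"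
      unfolding escape_time_less_iff by blast
  qed
  also have "\<dots> \<in> sets (P x)"
  proof (rule sets.countable_UN')
    show "countable ?Q" by (rule countable_subset[OF _ countable_rat]) blast
    show "(\<lambda>q. {\<omega> \<in> space (P x). X q \<omega> \<in> {y}}) ` ?Q \<subseteq> sets (P x)"
      using sets_X by blast
  qed
  finally show "{\<omega> \<in> space (P x). escape_time X (UNIV - {y}) \<omega> < c} \<in> sets (P x)" .
qed

text \<open>The hitting time of \<open>y\<close> cut off at the deterministic time \<open>a\<close>, which makes it finite.\<close>

definition stopped_time :: "real \<Rightarrow> 'a \<Rightarrow> 'w \<Rightarrow> real" where
  "stopped_time a y \<omega> = real_of_ereal (min (escape_time X (UNIV - {y}) \<omega>) (ereal a))"

lemma ereal_stopped_time:
  assumes "0 \<le> a"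
  shows "ereal (stopped_time a y \<omega>) = min (escape_time X (UNIV - {y}) \<omega>) (ereal a)"
  using escape_time_nonneg[of "UNIV - {y}" \<omega>] assms unfolding stopped_time_def
  by (cases "escape_time X (UNIV - {y}) \<omega>") (auto simp: min_def)

lemma stopped_time_bounds:
  assumes "0 \<le> a"
  shows "0 \<le> stopped_time a y \<omega>" "stopped_time a y \<omega> \<le> a"
proof -
  have "ereal 0 \<le> ereal (stopped_time a y \<omega>)" "ereal (stopped_time a y \<omega>) \<le> ereal a"
    unfolding ereal_stopped_time[OF assms] using assms escape_time_nonneg[of "UNIV - {y}" \<omega>] by (simp_all add: zero_ereal_def)
  then show "0 \<le> stopped_time a y \<omega>" "stopped_time a y \<omega> \<le> a" by simp_all
qed

lemma before_stopped_time:
  assumes "0 \<le> a" "0 \<le> s" "s < stopped_time a y \<omega>"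
  shows "X s \<omega> \<noteq> y"
proof (rule before_escape_time[OF assms(2)])
  have "ereal s < ereal (stopped_time a y \<omega>)" using assms(3) by simp
  then show "ereal s < escape_time X (UNIV - {y}) \<omega>"
    unfolding ereal_stopped_time[OF assms(1)] by simp
qed

lemma X_stopped_time:
  assumes "0 \<le> a" "\<omega> \<in> space (P x)" "stopped_time a y \<omega> < a"
  shows "X (stopped_time a y \<omega>) \<omega> = y"
proof (rule X_escape_time[OF assms(2)])
  have "ereal (stopped_time a y \<omega>) < ereal a" using assms(3) by simp
  then show "escape_time X (UNIV - {y}) \<omega> = ereal (stopped_time a y \<omega>)"
    unfolding ereal_stopped_time[OF assms(1)] by (simp add: min_def split: if_splits)
qed

lemma borel_measurable_stopped_time: "stopped_time a y \<in> borel_measurable (P x)"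
  unfolding stopped_time_def
  by (intro borel_measurable_real_of_ereal borel_measurable_min borel_measurable_const
      borel_measurable_escape_time)

lemma path_set_integrable:
  fixes g :: "'a \<Rightarrow> real"
  assumes "\<omega> \<in> space (P x)" "0 \<le> a"
  shows "set_integrable lborel {a..<b} (\<lambda>s. g (X s \<omega>))"
proof -
  obtain C where C: "0 \<le> C" "\<And>z. \<bar>g z\<bar> \<le> C"
    using finite_type_bounded[of g] by metis
  have eq: "indicator {a..<b} s *\<^sub>R g (X s \<omega>) = indicator {a..<b} s *\<^sub>R g (X (max 0 s) \<omega>)" for s
    using assms(2) by (simp add: indicator_def)
  have "integrable lborel (\<lambda>s. C * indicator {a..<b} s)"
    by (rule integrable_indicator_Ico)
  then show ?thesis
    unfolding set_integrable_def eq
  proof (rule Bochner_Integration.integrable_bound)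
    show "(\<lambda>s. indicator {a..<b} s *\<^sub>R g (X (max 0 s) \<omega>)) \<in> borel_measurable lborel"
      by (intro borel_measurable_scaleR borel_measurable_indicator measurable_path[OF assms(1)]) simp
    show "AE s in lborel. norm (indicator {a..<b} s *\<^sub>R g (X (max 0 s) \<omega>)) \<le> norm (C * indicator {a..<b} s)"
    proof (rule AE_I2)
      fix s
      have "\<bar>g (X (max 0 s) \<omega>)\<bar> \<le> \<bar>C\<bar>" using C(2)[of "X (max 0 s) \<omega>"] by linarith
      then show "norm (indicator {a..<b} s *\<^sub>R g (X (max 0 s) \<omega>)) \<le> norm (C * indicator {a..<b} s)"
        by (cases "s \<in> {a..<b}") simp_all
    qed
  qed
qed

lemma path_integral_bound:
  fixes g :: "'a \<Rightarrow> real"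
  assumes "\<omega> \<in> space (P x)" "0 \<le> a" "a \<le> b" and C: "\<And>z. \<bar>g z\<bar> \<le> C"
  shows "\<bar>LBINT s:{a..<b}. g (X s \<omega>)\<bar> \<le> C * (b - a)"
proof -
  have "\<bar>LBINT s:{a..<b}. g (X s \<omega>)\<bar> \<le> (\<integral>s. C * indicator {a..<b} s \<partial>lborel)"
    unfolding set_lebesgue_integral_def
  proof (rule integral_abs_bound_integral)
    show "integrable lborel (\<lambda>s. indicator {a..<b} s *\<^sub>R g (X s \<omega>))"
      using path_set_integrable[OF assms(1,2), of b g] unfolding set_integrable_def .
    show "integrable lborel (\<lambda>s. C * indicator {a..<b} s)"
      by (rule integrable_indicator_Ico)
    show "\<bar>indicator {a..<b} s *\<^sub>R g (X s \<omega>)\<bar> \<le> C * indicator {a..<b} s" for s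
      using C by (simp add: indicator_def)
  qed
  then show ?thesis using assms(3) by simp
qed

lemma path_integral_split:
  fixes g :: "'a \<Rightarrow> real"
  assumes "\<omega> \<in> space (P x)" "0 \<le> a" "a \<le> b" "b \<le> c"
  shows "(LBINT s:{a..<c}. g (X s \<omega>)) = (LBINT s:{a..<b}. g (X s \<omega>)) + (LBINT s:{b..<c}. g (X s \<omega>))"
proof -
  have "{a..<c} = {a..<b} \<union> {b..<c}" using assms(3,4) by auto
  then show ?thesis
    using set_integral_Un[OF _ path_set_integrable[OF assms(1,2), of b g] path_set_integrable[OF assms(1), of b c g]] assms(2,3)
    by auto
qed

lemma path_integral_grid:
  fixes g :: "'a \<Rightarrow> real"
  assumes "\<omega> \<in> space (P x)" "0 \<le> h"
  shows "(LBINT s:{0..<real m * h}. g (X s \<omega>)) = (\<Sum>j<m. LBINT s:{real j * h..<real (Suc j) * h}. g (X s \<omega>))"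
proof (induction m)
  case 0
  show ?case by (simp add: set_lebesgue_integral_def)
next
  case (Suc m)
  have "(LBINT s:{0..<real (Suc m) * h}. g (X s \<omega>)) = (LBINT s:{0..<real m * h}. g (X s \<omega>))
      + (LBINT s:{real m * h..<real (Suc m) * h}. g (X s \<omega>))"
    using assms(2) by (intro path_integral_split[OF assms(1)]) (auto intro: mult_right_mono)
  then show ?case using Suc.IH by simp
qed

lemma borel_measurable_path_integral:
  fixes g :: "'a \<Rightarrow> real"
  assumes "0 \<le> a"
  shows "(\<lambda>\<omega>. LBINT s:{a..<b}. g (X s \<omega>)) \<in> borel_measurable (P x)"
proof -
  have eq: "indicator {a..<b} s *\<^sub>R g (X s \<omega>) = indicator {a..<b} s * g (X (max 0 s) \<omega>)" for s \<omega>
    using assms by (simp add: indicator_def)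
  have "(\<lambda>p. indicator {a..<b} (snd p) * g (X (max 0 (snd p)) (fst p))) \<in> borel_measurable (P x \<Otimes>\<^sub>M lborel)"
    by (intro borel_measurable_times measurable_pair_X measurable_compose[OF measurable_snd]
        borel_measurable_indicator) auto
  then have "(\<lambda>(\<omega>, s). indicator {a..<b} s * g (X (max 0 s) \<omega>)) \<in> borel_measurable (P x \<Otimes>\<^sub>M lborel)"
    by (simp only: case_prod_beta')
  then show ?thesis
    unfolding set_lebesgue_integral_def eq by (rule lborel.borel_measurable_lebesgue_integral)
qed

section \<open>Dynkin's formula for the stopped process\<close>

text \<open>The index of the first visit to \<open>y\<close> on the grid of mesh \<open>h\<close>; the disjunct \<open>j = N\<close> makes
  \<open>N\<close> the value if no earlier visit is observed.\<close>

definition grid_hit :: "real \<Rightarrow> 'a \<Rightarrow> nat \<Rightarrow> 'w \<Rightarrow> nat" where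
  "grid_hit h y N \<omega> = (LEAST j. j = N \<or> X (real j * h) \<omega> = y)"

lemma grid_hit_le: "grid_hit h y N \<omega> \<le> N"
  unfolding grid_hit_def by (rule Least_le) simp

lemma grid_hit_cases: "grid_hit h y N \<omega> = N \<or> X (real (grid_hit h y N \<omega>) * h) \<omega> = y"
  unfolding grid_hit_def by (rule LeastI[of "\<lambda>j. j = N \<or> X (real j * h) \<omega> = y" N]) simp

lemma grid_time_le:
  assumes "0 \<le> a"
  shows "real (grid_hit (a / real (Suc n)) y (Suc n) \<omega>) * (a / real (Suc n)) \<le> a"
proof -
  have "real (grid_hit (a / real (Suc n)) y (Suc n) \<omega>) \<le> real (Suc n)"
    by (rule of_nat_mono[OF grid_hit_le])
  then have "real (grid_hit (a / real (Suc n)) y (Suc n) \<omega>) * (a / real (Suc n)) \<le> real (Suc n) * (a / real (Suc n))"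
    using assms by (rule mult_right_mono[OF _ divide_nonneg_nonneg]) (rule of_nat_0_le_iff)
  then show ?thesis by simp
qed

text \<open>Non-anticipation: whether the grid hitting time exceeds \<open>j\<close> is decided by the states at the
  grid times up to \<open>j\<close>. This makes the Markov property applicable to the next increment.\<close>

lemma less_grid_hit_iff:
  assumes "\<omega> \<in> space (P x)" "j < N"
  shows "j < grid_hit h y N \<omega> \<longleftrightarrow> \<omega> \<in> cylinder x (\<lambda>i. real i * h) (\<lambda>_. - {y}) j"
proof
  assume j: "j < grid_hit h y N \<omega>"
  have "X (real i * h) \<omega> \<noteq> y" if "i \<le> j" for i
  proof -
    have "i < (LEAST j. j = N \<or> X (real j * h) \<omega> = y)"
      using that j unfolding grid_hit_def by (rule le_less_trans)
    from not_less_Least[OF this] show ?thesis by blast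
  qed
  then show "\<omega> \<in> cylinder x (\<lambda>i. real i * h) (\<lambda>_. - {y}) j"
    using assms(1) unfolding cylinder_def by blast
next
  assume c: "\<omega> \<in> cylinder x (\<lambda>i. real i * h) (\<lambda>_. - {y}) j"
  show "j < grid_hit h y N \<omega>"
  proof (rule ccontr)
    assume "\<not> j < grid_hit h y N \<omega>"
    then have le: "grid_hit h y N \<omega> \<le> j" by simp
    then have "X (real (grid_hit h y N \<omega>) * h) \<omega> = y"
      using grid_hit_cases[of h y N \<omega>] assms(2) by (metis leD)
    with c le show False unfolding cylinder_def by blast
  qed
qed

lemma sum_less_grid_hit:
  fixes a :: "nat \<Rightarrow> real"
  assumes "\<omega> \<in> space (P x)"
  shows "(\<Sum>j<grid_hit h y N \<omega>. a j)
    = (\<Sum>j<N. indicator (cylinder x (\<lambda>i. real i * h) (\<lambda>_. - {y}) j) \<omega> * a j)"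
proof -
  let ?D = "\<lambda>j. cylinder x (\<lambda>i. real i * h) (\<lambda>_. - {y}) j"
  show ?thesis
  proof (rule sum.mono_neutral_cong_left)
    show "{..<grid_hit h y N \<omega>} \<subseteq> {..<N}"
      using grid_hit_le by (rule lessThan_subset_iff[THEN iffD2])
    show "\<forall>j\<in>{..<N} - {..<grid_hit h y N \<omega>}. indicator (?D j) \<omega> * a j = 0"
    proof
      fix j assume "j \<in> {..<N} - {..<grid_hit h y N \<omega>}"
      then have "\<omega> \<notin> ?D j" using less_grid_hit_iff[OF assms, of j N h y] by blast
      then show "indicator (?D j) \<omega> * a j = 0" by simp
    qed
    fix j assume j: "j \<in> {..<grid_hit h y N \<omega>}"
    then have "j < N" using grid_hit_le[of h y N \<omega>] by (metis lessThan_iff less_le_trans)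
    then have "\<omega> \<in> ?D j" using j less_grid_hit_iff[OF assms, of j N h y] by blast
    then show "a j = indicator (?D j) \<omega> * a j" by simp
  qed simp
qed

lemma measurable_grid_hit:
  assumes "0 \<le> h"
  shows "grid_hit h y N \<in> P x \<rightarrow>\<^sub>M count_space UNIV"
  unfolding grid_hit_def
proof (rule measurable_Least)
  fix j
  have "{\<omega> \<in> space (P x). X (real j * h) \<omega> \<in> {y} \<union> {z. j = N}} \<in> sets (P x)"
    using assms by (intro sets_X) simp
  also have "{\<omega> \<in> space (P x). X (real j * h) \<omega> \<in> {y} \<union> {z. j = N}}
      = {\<omega> \<in> space (P x). j = N \<or> X (real j * h) \<omega> = y}" by auto
  finally show "(\<lambda>\<omega>. j = N \<or> X (real j * h) \<omega> = y) \<in> P x \<rightarrow>\<^sub>M count_space UNIV"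
    unfolding pred_def .
qed

lemma integrable_bounded:
  fixes F :: "'w \<Rightarrow> real"
  assumes "F \<in> borel_measurable (P x)" "\<And>\<omega>. \<omega> \<in> space (P x) \<Longrightarrow> \<bar>F \<omega>\<bar> \<le> C"
  shows "integrable (P x) F"
  using assms by (intro P.integrable_const_bound[of _ C]) auto

text \<open>Optional stopping in discrete time: the increment over the \<open>j\<close>-th mesh interval is taken
  on the cylinder event that \<open>y\<close> has not been seen on the grid up to \<open>j\<close>, and the sum over
  \<open>j\<close> telescopes. The process may visit \<open>y\<close> unnoticed between grid times; the
  identity is nevertheless exact, because the integral runs up to the grid hitting time.\<close>

lemma dynkin_grid:
  fixes u :: "'a \<Rightarrow> real"
  assumes "0 \<le> h"
  shows "(\<integral>\<omega>. u (X (real (grid_hit h y N \<omega>) * h) \<omega>) \<partial>P x) - u x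
    = (\<integral>\<omega>. (LBINT s:{0..<real (grid_hit h y N \<omega>) * h}. generator k u (X s \<omega>)) \<partial>P x)"
proof -
  let ?D = "\<lambda>j. cylinder x (\<lambda>i. real i * h) (\<lambda>_. - {y}) j"
  let ?L = "generator k u"
  let ?du = "\<lambda>j \<omega>. u (X (real (Suc j) * h) \<omega>) - u (X (real j * h) \<omega>)"
  let ?I = "\<lambda>j \<omega>. LBINT s:{real j * h..<real (Suc j) * h}. ?L (X s \<omega>)"
  have grid: "0 \<le> real j * h" "real j * h \<le> real (Suc j) * h" for j
    using assms by (auto intro: mult_right_mono)
  have D: "?D j \<in> sets (P x)" for j using grid(1) by (intro sets_cylinder)
  obtain C where C: "0 \<le> C" "\<And>z. \<bar>?L z\<bar> \<le> C"
    using finite_type_bounded[of ?L] by metis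
  obtain C' where C': "0 \<le> C'" "\<And>z. \<bar>u z\<bar> \<le> C'"
    using finite_type_bounded[of u] by metis
  have int_X: "integrable (P x) (\<lambda>\<omega>. u (X s \<omega>))" if "0 \<le> s" for s
    using C'(2) by (intro integrable_bounded measurable_comp_X that)
  have int_du: "integrable (P x) (\<lambda>\<omega>. indicator (?D j) \<omega> * ?du j \<omega>)" for j
  proof (rule integrable_bounded)
    show "(\<lambda>\<omega>. indicator (?D j) \<omega> * ?du j \<omega>) \<in> borel_measurable (P x)"
      by (intro borel_measurable_times borel_measurable_indicator borel_measurable_diff
          measurable_comp_X D grid)
    fix \<omega>
    have "\<bar>?du j \<omega>\<bar> \<le> 2 * C'"
      using C'(2)[of "X (real (Suc j) * h) \<omega>"] C'(2)[of "X (real j * h) \<omega>"] by linarith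
    then show "\<bar>indicator (?D j) \<omega> * ?du j \<omega>\<bar> \<le> 2 * C'"
      using C'(1) by (cases "\<omega> \<in> ?D j") (simp_all del: of_nat_Suc)
  qed
  have int_I: "integrable (P x) (\<lambda>\<omega>. indicator (?D j) \<omega> * ?I j \<omega>)" for j
  proof (rule integrable_bounded)
    show "(\<lambda>\<omega>. indicator (?D j) \<omega> * ?I j \<omega>) \<in> borel_measurable (P x)"
      by (intro borel_measurable_times borel_measurable_indicator borel_measurable_path_integral D grid)
    fix \<omega> assume "\<omega> \<in> space (P x)"
    then have "\<bar>?I j \<omega>\<bar> \<le> C * (real (Suc j) * h - real j * h)"
      using grid C(2) by (rule path_integral_bound)
    moreover have "0 \<le> C * (real (Suc j) * h - real j * h)"
      using C(1) grid(2)[of j] by (intro mult_nonneg_nonneg) simp_all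
    ultimately show "\<bar>indicator (?D j) \<omega> * ?I j \<omega>\<bar> \<le> C * (real (Suc j) * h - real j * h)"
      by (cases "\<omega> \<in> ?D j") (simp_all del: of_nat_Suc)
  qed
  have telescope: "u (X (real (grid_hit h y N \<omega>) * h) \<omega>) = u (X 0 \<omega>) + (\<Sum>j<N. indicator (?D j) \<omega> * ?du j \<omega>)"
    if "\<omega> \<in> space (P x)" for \<omega>
    unfolding sum_less_grid_hit[OF that, symmetric]
    using sum_lessThan_telescope[of "\<lambda>j. u (X (real j * h) \<omega>)" "grid_hit h y N \<omega>"] by simp
  have "(\<integral>\<omega>. u (X 0 \<omega>) \<partial>P x) = (\<integral>\<omega>. u x \<partial>P x)"
  proof (rule integral_cong_AE)
    show "AE \<omega> in P x. u (X 0 \<omega>) = u x" using X_0[of x] by (rule eventually_mono) simp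
    show "(\<lambda>\<omega>. u (X 0 \<omega>)) \<in> borel_measurable (P x)" by (rule measurable_comp_X) simp
  qed simp
  then have start: "(\<integral>\<omega>. u (X 0 \<omega>) \<partial>P x) = u x" by (simp add: P.prob_space)
  have "(\<integral>\<omega>. u (X (real (grid_hit h y N \<omega>) * h) \<omega>) \<partial>P x)
      = (\<integral>\<omega>. u (X 0 \<omega>) + (\<Sum>j<N. indicator (?D j) \<omega> * ?du j \<omega>) \<partial>P x)"
    by (rule Bochner_Integration.integral_cong[OF refl telescope])
  also have "\<dots> = (\<integral>\<omega>. u (X 0 \<omega>) \<partial>P x) + (\<integral>\<omega>. (\<Sum>j<N. indicator (?D j) \<omega> * ?du j \<omega>) \<partial>P x)"
    by (intro Bochner_Integration.integral_add int_X Bochner_Integration.integrable_sum int_du) simp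
  also have "(\<integral>\<omega>. (\<Sum>j<N. indicator (?D j) \<omega> * ?du j \<omega>) \<partial>P x) = (\<Sum>j<N. \<integral>\<omega>. indicator (?D j) \<omega> * ?du j \<omega> \<partial>P x)"
    by (intro Bochner_Integration.integral_sum int_du)
  also have "\<dots> = (\<Sum>j<N. \<integral>\<omega>. indicator (?D j) \<omega> * ?I j \<omega> \<partial>P x)"
  proof (rule sum.cong[OF refl])
    fix j
    show "(\<integral>\<omega>. indicator (?D j) \<omega> * ?du j \<omega> \<partial>P x) = (\<integral>\<omega>. indicator (?D j) \<omega> * ?I j \<omega> \<partial>P x)"
      by (rule dynkin_step[where t = "\<lambda>i. real i * h"]) (simp, (rule grid(2))+)
  qed
  also have "\<dots> = (\<integral>\<omega>. (\<Sum>j<N. indicator (?D j) \<omega> * ?I j \<omega>) \<partial>P x)"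
    by (intro Bochner_Integration.integral_sum[symmetric] int_I)
  also have "\<dots> = (\<integral>\<omega>. (LBINT s:{0..<real (grid_hit h y N \<omega>) * h}. ?L (X s \<omega>)) \<partial>P x)"
  proof (rule Bochner_Integration.integral_cong[OF refl])
    fix \<omega> assume \<omega>: "\<omega> \<in> space (P x)"
    show "(\<Sum>j<N. indicator (?D j) \<omega> * ?I j \<omega>)
        = (LBINT s:{0..<real (grid_hit h y N \<omega>) * h}. ?L (X s \<omega>))"
      unfolding path_integral_grid[OF \<omega> assms] sum_less_grid_hit[OF \<omega>] ..
  qed
  finally show ?thesis by (simp only: start add_diff_cancel_left')
qed

text \<open>If the cutoff \<open>a\<close> comes first, no earlier grid time sees \<open>y\<close> and the grid time is \<open>a\<close> itself.
  Otherwise the path stays in \<open>y\<close> for a while after \<open>S\<close>, and once the mesh is shorter than this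
  sojourn, the first grid time after \<open>S\<close> already sees \<open>y\<close>.\<close>

lemma grid_hit_converges:
  fixes y :: 'a and \<omega> :: 'w and a :: real
  assumes "0 < a" "\<omega> \<in> space (P x)"
  defines "S \<equiv> stopped_time a y \<omega>"
  defines "\<tau> \<equiv> \<lambda>n. real (grid_hit (a / real (Suc n)) y (Suc n) \<omega>) * (a / real (Suc n))"
  shows "\<forall>\<^sub>F n in sequentially. S \<le> \<tau> n \<and> \<tau> n \<le> S + a / real (Suc n) \<and> X (\<tau> n) \<omega> = X S \<omega>"
proof -
  have "0 \<le> a" using assms(1) by simp
  note S_bounds = stopped_time_bounds[OF \<open>0 \<le> a\<close>, of y \<omega>, folded S_def]
  have \<tau>_le: "\<tau> n \<le> a" for n
    unfolding \<tau>_def by (rule grid_time_le[OF \<open>0 \<le> a\<close>])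
  have S_le: "S \<le> \<tau> n" for n
  proof (cases "X (\<tau> n) \<omega> = y")
    case True
    have "0 \<le> \<tau> n" unfolding \<tau>_def using assms(1) by simp
    then show ?thesis
      using before_stopped_time[OF \<open>0 \<le> a\<close>, of "\<tau> n" y \<omega>] True unfolding S_def by force
  next
    case False
    then have "grid_hit (a / real (Suc n)) y (Suc n) \<omega> = Suc n"
      using grid_hit_cases[of "a / real (Suc n)" y "Suc n" \<omega>] unfolding \<tau>_def by blast
    then have "\<tau> n = a" unfolding \<tau>_def by simp
    then show ?thesis using S_bounds(2) by simp
  qed
  show ?thesis
  proof (cases "S = a")
    case True
    then have "\<tau> n = S" for n using S_le[of n] \<tau>_le[of n] by simp
    then show ?thesis using assms(1) by simp
  next
    case False
    then have "S < a" using S_bounds(2) by simp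
    then have XS: "X S \<omega> = y" using X_stopped_time[OF \<open>0 \<le> a\<close> assms(2)] unfolding S_def by simp
    obtain b where b: "S < b" "\<And>r. S \<le> r \<Longrightarrow> r < b \<Longrightarrow> X r \<omega> = X S \<omega>"
      using right_constant[OF assms(2) S_bounds(1)] by metis
    have "(\<lambda>n. a / real (Suc n)) \<longlonglongrightarrow> 0"
      by (rule LIMSEQ_Suc[OF lim_const_over_n])
    then have "\<forall>\<^sub>F n in sequentially. a / real (Suc n) < min b a - S"
      by (rule order_tendstoD) (use b(1) \<open>S < a\<close> in simp)
    then show ?thesis
    proof eventually_elim
      case (elim n)
      define h where "h = a / real (Suc n)"
      have "0 < h" using assms(1) by (simp add: h_def)
      \<comment> \<open>The first grid index not before \<open>S\<close>.\<close>
      define j where "j = nat \<lceil>S / h\<rceil>"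
      have j_real: "real j = of_int \<lceil>S / h\<rceil>"
        unfolding j_def using S_bounds(1) \<open>0 < h\<close> by simp
      have "S / h \<le> real j" "real j < S / h + 1" unfolding j_real by linarith+
      then have j: "S \<le> real j * h" "real j * h < S + h"
        using \<open>0 < h\<close> by (simp_all add: field_simps)
      have small: "h < b - S" "h < a - S" using elim unfolding h_def by simp_all
      have "X (real j * h) \<omega> = y" using b(2)[of "real j * h"] j small XS by simp
      then have "grid_hit h y (Suc n) \<omega> \<le> j" unfolding grid_hit_def by (intro Least_le) simp
      then have "\<tau> n \<le> real j * h"
        unfolding \<tau>_def h_def[symmetric] using \<open>0 < h\<close> by (intro mult_right_mono) auto
      then have "\<tau> n < S + h" using j(2) by simp
      then show ?case using S_le[of n] b(2)[of "\<tau> n"] small unfolding h_def[symmetric] by simp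
    qed
  qed
qed

lemma path_integral_tendsto:
  fixes g :: "'a \<Rightarrow> real"
  assumes "\<omega> \<in> space (P x)" "0 \<le> S" "\<forall>\<^sub>F n in sequentially. S \<le> \<tau> n \<and> \<tau> n \<le> S + e n" "e \<longlonglongrightarrow> 0"
  shows "(\<lambda>n. LBINT s:{0..<\<tau> n}. g (X s \<omega>)) \<longlonglongrightarrow> (LBINT s:{0..<S}. g (X s \<omega>))"
proof -
  obtain C where C: "0 \<le> C" "\<And>z. \<bar>g z\<bar> \<le> C"
    using finite_type_bounded[of g] by metis
  have "(\<lambda>n. C * e n) \<longlonglongrightarrow> C * 0" by (intro tendsto_intros assms(4))
  then have lim: "(\<lambda>n. C * e n) \<longlonglongrightarrow> 0" by simp
  have "\<forall>\<^sub>F n in sequentially. norm ((LBINT s:{0..<\<tau> n}. g (X s \<omega>)) - (LBINT s:{0..<S}. g (X s \<omega>))) \<le> C * e n"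
    using assms(3)
  proof eventually_elim
    case (elim n)
    then have "(LBINT s:{0..<\<tau> n}. g (X s \<omega>)) - (LBINT s:{0..<S}. g (X s \<omega>)) = (LBINT s:{S..<\<tau> n}. g (X s \<omega>))"
      using path_integral_split[OF assms(1) order_refl assms(2), of "\<tau> n" g] by simp
    also have "\<bar>\<dots>\<bar> \<le> C * (\<tau> n - S)"
      using elim by (intro path_integral_bound[OF assms(1,2)] C(2)) simp
    also have "\<dots> \<le> C * e n" using elim C(1) by (intro mult_left_mono) auto
    finally show ?case by simp
  qed
  then show ?thesis by (rule LIM_zero_cancel[OF Lim_null_comparison[OF _ lim]])
qed

text \<open>Both random variables are pointwise limits of their grid versions, which are uniformly
  bounded because the cutoff bounds the grid times by \<open>a\<close>.\<close>

lemma dynkin_formula: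
  fixes u :: "'a \<Rightarrow> real"
  assumes "0 < a"
  shows "integrable (P x) (\<lambda>\<omega>. u (X (stopped_time a y \<omega>) \<omega>))"
    and "integrable (P x) (\<lambda>\<omega>. LBINT s:{0..<stopped_time a y \<omega>}. generator k u (X s \<omega>))"
    and "(\<integral>\<omega>. u (X (stopped_time a y \<omega>) \<omega>) \<partial>P x) - u x
      = (\<integral>\<omega>. (LBINT s:{0..<stopped_time a y \<omega>}. generator k u (X s \<omega>)) \<partial>P x)"
proof -
  let ?L = "generator k u"
  define \<tau> where "\<tau> n \<omega> = real (grid_hit (a / real (Suc n)) y (Suc n) \<omega>) * (a / real (Suc n))" for n \<omega>
  have "0 \<le> a" using assms by simp
  have h: "0 \<le> a / real (Suc n)" for n using assms by simp
  obtain C where C: "0 \<le> C" "\<And>z. \<bar>?L z\<bar> \<le> C"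
    using finite_type_bounded[of ?L] by metis
  obtain C' where C': "0 \<le> C'" "\<And>z. \<bar>u z\<bar> \<le> C'"
    using finite_type_bounded[of u] by metis
  have \<tau>: "0 \<le> \<tau> n \<omega>" "\<tau> n \<omega> \<le> a" for n \<omega>
  proof -
    show "0 \<le> \<tau> n \<omega>" unfolding \<tau>_def using h[of n] by (intro mult_nonneg_nonneg) auto
    show "\<tau> n \<omega> \<le> a" unfolding \<tau>_def by (rule grid_time_le[OF \<open>0 \<le> a\<close>])
  qed
  have grid: "0 \<le> real j * (a / real (Suc n))" for j n
    using h[of n] by (intro mult_nonneg_nonneg) simp_all
  have meas_u: "(\<lambda>\<omega>. u (X (\<tau> n \<omega>) \<omega>)) \<in> borel_measurable (P x)" for n
    unfolding \<tau>_def
    by (rule measurable_compose_countable[where f = "\<lambda>j \<omega>. u (X (real j * (a / real (Suc n))) \<omega>)",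
          OF measurable_comp_X[OF grid] measurable_grid_hit[OF h]])
  have meas_I: "(\<lambda>\<omega>. LBINT s:{0..<\<tau> n \<omega>}. ?L (X s \<omega>)) \<in> borel_measurable (P x)" for n
    unfolding \<tau>_def
    by (rule measurable_compose_countable[where f = "\<lambda>j \<omega>. LBINT s:{0..<real j * (a / real (Suc n))}. ?L (X s \<omega>)",
          OF borel_measurable_path_integral[OF order_refl] measurable_grid_hit[OF h]])
  have lim_u: "(\<lambda>n. u (X (\<tau> n \<omega>) \<omega>)) \<longlonglongrightarrow> u (X (stopped_time a y \<omega>) \<omega>)" if "\<omega> \<in> space (P x)" for \<omega>
  proof -
    have "\<forall>\<^sub>F n in sequentially. u (X (\<tau> n \<omega>) \<omega>) = u (X (stopped_time a y \<omega>) \<omega>)"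
      using grid_hit_converges[OF assms that, of y] unfolding \<tau>_def by (rule eventually_mono) simp
    then show ?thesis by (rule tendsto_eventually)
  qed
  have lim_I: "(\<lambda>n. LBINT s:{0..<\<tau> n \<omega>}. ?L (X s \<omega>)) \<longlonglongrightarrow> (LBINT s:{0..<stopped_time a y \<omega>}. ?L (X s \<omega>))"
    if "\<omega> \<in> space (P x)" for \<omega>
  proof (rule path_integral_tendsto[OF that])
    show "0 \<le> stopped_time a y \<omega>" using stopped_time_bounds[OF \<open>0 \<le> a\<close>] by simp
    show "\<forall>\<^sub>F n in sequentially. stopped_time a y \<omega> \<le> \<tau> n \<omega> \<and> \<tau> n \<omega> \<le> stopped_time a y \<omega> + a / real (Suc n)"
      using grid_hit_converges[OF assms that, of y] unfolding \<tau>_def by (rule eventually_mono) blast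
    show "(\<lambda>n. a / real (Suc n)) \<longlonglongrightarrow> 0"
      by (rule LIMSEQ_Suc[OF lim_const_over_n])
  qed
  have meas_u': "(\<lambda>\<omega>. u (X (stopped_time a y \<omega>) \<omega>)) \<in> borel_measurable (P x)"
    using lim_u meas_u by (rule borel_measurable_LIMSEQ_real)
  have meas_I': "(\<lambda>\<omega>. LBINT s:{0..<stopped_time a y \<omega>}. ?L (X s \<omega>)) \<in> borel_measurable (P x)"
    using lim_I meas_I by (rule borel_measurable_LIMSEQ_real)
  show "integrable (P x) (\<lambda>\<omega>. u (X (stopped_time a y \<omega>) \<omega>))"
    using meas_u' C'(2) by (rule integrable_bounded)
  show "integrable (P x) (\<lambda>\<omega>. LBINT s:{0..<stopped_time a y \<omega>}. ?L (X s \<omega>))"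
  proof (rule integrable_bounded[OF meas_I'])
    fix \<omega> assume \<omega>: "\<omega> \<in> space (P x)"
    show "\<bar>LBINT s:{0..<stopped_time a y \<omega>}. ?L (X s \<omega>)\<bar> \<le> C * a"
      using path_integral_bound[where g = ?L, OF \<omega> order_refl stopped_time_bounds(1)[OF \<open>0 \<le> a\<close>] C(2), of y \<omega>]
        mult_left_mono[OF stopped_time_bounds(2)[OF \<open>0 \<le> a\<close>, of y \<omega>] C(1)] by simp
  qed
  have "(\<lambda>n. \<integral>\<omega>. u (X (\<tau> n \<omega>) \<omega>) \<partial>P x) \<longlonglongrightarrow> (\<integral>\<omega>. u (X (stopped_time a y \<omega>) \<omega>) \<partial>P x)"
  proof (rule integral_dominated_convergence[where w = "\<lambda>_. C'"])
    show "AE \<omega> in P x. (\<lambda>n. u (X (\<tau> n \<omega>) \<omega>)) \<longlonglongrightarrow> u (X (stopped_time a y \<omega>) \<omega>)"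
      by (rule AE_I2) (rule lim_u)
    show "AE \<omega> in P x. norm (u (X (\<tau> n \<omega>) \<omega>)) \<le> C'" for n
      unfolding real_norm_def by (rule AE_I2) (rule C'(2))
  qed (rule meas_u' meas_u P.integrable_const)+
  then have lim_E: "(\<lambda>n. (\<integral>\<omega>. u (X (\<tau> n \<omega>) \<omega>) \<partial>P x) - u x) \<longlonglongrightarrow> (\<integral>\<omega>. u (X (stopped_time a y \<omega>) \<omega>) \<partial>P x) - u x"
    by (intro tendsto_intros)
  have lim_EI: "(\<lambda>n. \<integral>\<omega>. (LBINT s:{0..<\<tau> n \<omega>}. ?L (X s \<omega>)) \<partial>P x)
      \<longlonglongrightarrow> (\<integral>\<omega>. (LBINT s:{0..<stopped_time a y \<omega>}. ?L (X s \<omega>)) \<partial>P x)"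
  proof (rule integral_dominated_convergence[where w = "\<lambda>_. C * a"])
    show "AE \<omega> in P x. norm (LBINT s:{0..<\<tau> n \<omega>}. ?L (X s \<omega>)) \<le> C * a" for n
    proof (rule AE_I2)
      fix \<omega> assume \<omega>: "\<omega> \<in> space (P x)"
      show "norm (LBINT s:{0..<\<tau> n \<omega>}. ?L (X s \<omega>)) \<le> C * a"
        using path_integral_bound[where g = ?L, OF \<omega> order_refl \<tau>(1)[of n \<omega>] C(2)] mult_left_mono[OF \<tau>(2)[of n \<omega>] C(1)] by simp
    qed
    show "AE \<omega> in P x. (\<lambda>n. LBINT s:{0..<\<tau> n \<omega>}. ?L (X s \<omega>))
        \<longlonglongrightarrow> (LBINT s:{0..<stopped_time a y \<omega>}. ?L (X s \<omega>))"
      by (rule AE_I2) (rule lim_I)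
  qed (rule meas_I' meas_I P.integrable_const)+
  have eq: "(\<integral>\<omega>. u (X (\<tau> n \<omega>) \<omega>) \<partial>P x) - u x = (\<integral>\<omega>. (LBINT s:{0..<\<tau> n \<omega>}. ?L (X s \<omega>)) \<partial>P x)" for n
    unfolding \<tau>_def by (rule dynkin_grid[OF h])
  show "(\<integral>\<omega>. u (X (stopped_time a y \<omega>) \<omega>) \<partial>P x) - u x
      = (\<integral>\<omega>. (LBINT s:{0..<stopped_time a y \<omega>}. ?L (X s \<omega>)) \<partial>P x)"
    by (rule LIMSEQ_unique[OF lim_E[unfolded eq] lim_EI])
qed

section \<open>Removing the time cutoff\<close>

lemma SUP_stopped_time:
  "(SUP n. ennreal (stopped_time (real (Suc n)) y \<omega>)) = e2ennreal (escape_time X (UNIV - {y}) \<omega>)"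
proof -
  have S: "ennreal (stopped_time (real (Suc n)) y \<omega>)
      = min (e2ennreal (escape_time X (UNIV - {y}) \<omega>)) (of_nat (Suc n))" for n
  proof -
    have "ennreal (stopped_time (real (Suc n)) y \<omega>) = e2ennreal (ereal (stopped_time (real (Suc n)) y \<omega>))"
      by simp
    also have "\<dots> = e2ennreal (min (escape_time X (UNIV - {y}) \<omega>) (ereal (real (Suc n))))"
      by (subst ereal_stopped_time) simp_all
    also have "\<dots> = min (e2ennreal (escape_time X (UNIV - {y}) \<omega>)) (e2ennreal (ereal (real (Suc n))))"
      by (rule min_of_mono[symmetric]) (intro monoI e2ennreal_mono)
    also have "e2ennreal (ereal (real (Suc n))) = of_nat (Suc n)"
      by (simp add: ennreal_of_nat_eq_real_of_nat)
    finally show ?thesis .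
  qed
  show ?thesis
  proof (rule antisym)
    show "(SUP n. ennreal (stopped_time (real (Suc n)) y \<omega>)) \<le> e2ennreal (escape_time X (UNIV - {y}) \<omega>)"
      unfolding S by (rule SUP_least) simp
    show "e2ennreal (escape_time X (UNIV - {y}) \<omega>) \<le> (SUP n. ennreal (stopped_time (real (Suc n)) y \<omega>))"
    proof (cases "e2ennreal (escape_time X (UNIV - {y}) \<omega>) = \<top>")
      case True
      have "(SUP n. of_nat n :: ennreal) \<le> (SUP n. ennreal (stopped_time (real (Suc n)) y \<omega>))"
      proof (rule SUP_mono)
        fix n :: nat
        have "(of_nat n :: ennreal) \<le> of_nat (Suc n)" by (rule of_nat_mono) simp
        then show "\<exists>m\<in>UNIV. (of_nat n :: ennreal) \<le> ennreal (stopped_time (real (Suc m)) y \<omega>)"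
          unfolding S True by (intro bexI[of _ n]) (simp_all del: of_nat_Suc)
      qed
      then show ?thesis unfolding True ennreal_SUP_of_nat_eq_top .
    next
      case False
      then obtain n where "e2ennreal (escape_time X (UNIV - {y}) \<omega>) < of_nat n"
        using ennreal_Ex_less_of_nat by (auto simp: less_top)
      also have "(of_nat n :: ennreal) \<le> of_nat (Suc n)" by (rule of_nat_mono) simp
      finally have "e2ennreal (escape_time X (UNIV - {y}) \<omega>) = ennreal (stopped_time (real (Suc n)) y \<omega>)"
        unfolding S by (simp add: min_def less_imp_le)
      then show ?thesis by (metis SUP_upper UNIV_I)
    qed
  qed
qed

text \<open>With a Lyapunov function \<open>U\<close>, Dynkin's formula reads
  \<open>0 \<le> E U (X S) = U x + E (\<integral>\<^sub>0\<^sup>S L U (X s) ds) \<le> U x - E S\<close> for each cutoff time \<open>S\<close>, because the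
  state differs from \<open>y\<close> before \<open>S\<close>. Monotone convergence removes the cutoff.\<close>

lemma mean_first_passage_time_finite:
  assumes "irreducible_rates k"
  shows "mean_first_passage_time P X x y < \<infinity>"
proof -
  obtain U :: "'a \<Rightarrow> real" where U: "\<And>z. 0 \<le> U z" "\<And>z. z \<noteq> y \<Longrightarrow> generator k U z \<le> -1"
    using exists_lyapunov_function[OF rates_nonneg assms, of y] by metis
  let ?S = "\<lambda>n. stopped_time (real (Suc n)) y"
  have int_S: "integrable (P x) (?S n)" for n
  proof (rule integrable_bounded[OF borel_measurable_stopped_time])
    show "\<bar>?S n \<omega>\<bar> \<le> real (Suc n)" for \<omega>
      using stopped_time_bounds[of "real (Suc n)" y \<omega>] by simp
  qed
  have "(\<integral>\<omega>. ?S n \<omega> \<partial>P x) \<le> U x" for n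
  proof -
    note dynkin = dynkin_formula[where a = "real (Suc n)" and u = U and x = x and y = y]
    have "(LBINT s:{0..<?S n \<omega>}. generator k U (X s \<omega>)) \<le> - ?S n \<omega>" if \<omega>: "\<omega> \<in> space (P x)" for \<omega>
    proof -
      have S0: "0 \<le> ?S n \<omega>" by (rule stopped_time_bounds) simp
      have "(LBINT s:{0..<?S n \<omega>}. generator k U (X s \<omega>)) \<le> (\<integral>s. (-1) * indicator {0..<?S n \<omega>} s \<partial>lborel)"
        unfolding set_lebesgue_integral_def
      proof (rule integral_mono)
        show "integrable lborel (\<lambda>s. indicator {0..<?S n \<omega>} s *\<^sub>R generator k U (X s \<omega>))"
          using path_set_integrable[OF \<omega> order_refl, of "?S n \<omega>" "generator k U"]
          unfolding set_integrable_def .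
        show "integrable lborel (\<lambda>s. (-1) * indicator {0..<?S n \<omega>} s :: real)"
          by (rule integrable_indicator_Ico)
        show "indicator {0..<?S n \<omega>} s *\<^sub>R generator k U (X s \<omega>) \<le> (-1) * indicator {0..<?S n \<omega>} s" for s
        proof (cases "s \<in> {0..<?S n \<omega>}")
          case True
          then have "X s \<omega> \<noteq> y" using before_stopped_time[of "real (Suc n)" s y \<omega>] by simp
          then show ?thesis using True U(2)[of "X s \<omega>"] by simp
        qed simp
      qed
      then show ?thesis using S0 by simp
    qed
    then have "(\<integral>\<omega>. (LBINT s:{0..<?S n \<omega>}. generator k U (X s \<omega>)) \<partial>P x) \<le> (\<integral>\<omega>. - ?S n \<omega> \<partial>P x)"
      by (intro integral_mono dynkin Bochner_Integration.integrable_minus int_S) simp_all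
    moreover have "0 \<le> (\<integral>\<omega>. U (X (?S n \<omega>) \<omega>) \<partial>P x)"
      by (rule Bochner_Integration.integral_nonneg) (rule U(1))
    moreover have "0 < real (Suc n)" by simp
    ultimately show ?thesis using dynkin(3) by simp
  qed
  then have nn: "(\<integral>\<^sup>+\<omega>. ennreal (?S n \<omega>) \<partial>P x) \<le> ennreal (U x)" for n
    using nn_integral_eq_integral[OF int_S AE_I2, of n] stopped_time_bounds(1)[of "real (Suc n)" y]
    by (simp add: ennreal_leI)
  have "mean_first_passage_time P X x y = (\<integral>\<^sup>+\<omega>. (SUP n. ennreal (?S n \<omega>)) \<partial>P x)"
    unfolding mean_first_passage_time_def SUP_stopped_time ..
  also have "\<dots> = (SUP n. \<integral>\<^sup>+\<omega>. ennreal (?S n \<omega>) \<partial>P x)"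
  proof (rule nn_integral_monotone_convergence_SUP)
    show "incseq (\<lambda>n \<omega>. ennreal (?S n \<omega>))"
    proof (intro incseq_SucI le_funI ennreal_leI)
      fix n \<omega>
      have "min (escape_time X (UNIV - {y}) \<omega>) (ereal (real (Suc n)))
          \<le> min (escape_time X (UNIV - {y}) \<omega>) (ereal (real (Suc (Suc n))))"
        by (rule min.mono) simp_all
      then show "?S n \<omega> \<le> ?S (Suc n) \<omega>"
        by (simp only: ereal_stopped_time[OF of_nat_0_le_iff, symmetric] ereal_less_eq)
    qed
    show "(\<lambda>\<omega>. ennreal (?S n \<omega>)) \<in> borel_measurable (P x)" for n
      using borel_measurable_stopped_time by (rule measurable_compose) (rule measurable_ennreal)
  qed
  also have "\<dots> \<le> ennreal (U x)" by (rule SUP_least) (rule nn)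
  also have "\<dots> < \<infinity>" by simp
  finally show ?thesis .
qed

lemma accumulated_excess_eq:
  assumes "mean \<rho> f = 0" "escape_time X (UNIV - {y}) \<omega> = ereal r"
  shows "accumulated_excess X \<rho> f y \<omega> = (LBINT s:{0..<r}. f (X s \<omega>))"
proof -
  have "0 \<le> r" using escape_time_nonneg[of "UNIV - {y}" \<omega>] assms(2) by simp
  show ?thesis
    unfolding accumulated_excess_def assms zero_ereal_def interval_integral_Ico[OF \<open>0 \<le> r\<close>] diff_zero ..
qed

text \<open>The event of never reaching \<open>y\<close> is included: the integrand is jointly
  measurable for infinite upper limits as well, whatever the value of the integral is there.\<close>

lemma borel_measurable_accumulated_excess:
  "accumulated_excess X \<rho> f y \<in> borel_measurable (P x)"
proof -
  let ?T = "escape_time X (UNIV - {y})"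
  note borel_measurable_escape_time[measurable]
  let ?g = "\<lambda>z. f z - mean \<rho> f"
  have eq: "accumulated_excess X \<rho> f y \<omega>
      = (\<integral>s. indicator {0<..} s * (if ereal s < ?T \<omega> then ?g (X (max 0 s) \<omega>) else 0) \<partial>lborel)" for \<omega>
  proof -
    have "indicator (einterval 0 (?T \<omega>)) s *\<^sub>R ?g (X s \<omega>)
        = indicator {0<..} s * (if ereal s < ?T \<omega> then ?g (X (max 0 s) \<omega>) else 0)" for s
      by (simp add: indicator_def einterval_def)
    then show ?thesis
      using escape_time_nonneg[of "UNIV - {y}" \<omega>]
      unfolding accumulated_excess_def interval_lebesgue_integral_def set_lebesgue_integral_def by simp
  qed
  have "(\<lambda>p. if ereal (snd p) < ?T (fst p) then ?g (X (max 0 (snd p)) (fst p)) else 0)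
      \<in> borel_measurable (P x \<Otimes>\<^sub>M lborel)"
  proof (rule measurable_If)
    show "(\<lambda>p. ?g (X (max 0 (snd p)) (fst p))) \<in> borel_measurable (P x \<Otimes>\<^sub>M lborel)"
      by (rule measurable_pair_X)
    show "{p \<in> space (P x \<Otimes>\<^sub>M lborel). ereal (snd p) < ?T (fst p)} \<in> sets (P x \<Otimes>\<^sub>M lborel)"
      by measurable
  qed simp
  then have "(\<lambda>p. indicator {0<..} (snd p) * (if ereal (snd p) < ?T (fst p) then ?g (X (max 0 (snd p)) (fst p)) else 0))
      \<in> borel_measurable (P x \<Otimes>\<^sub>M lborel)"
    by (intro borel_measurable_times measurable_compose[OF measurable_snd] borel_measurable_indicator) simp
  then have "(\<lambda>(\<omega>, s). indicator {0<..} s * (if ereal s < ?T \<omega> then ?g (X (max 0 s) \<omega>) else 0))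
      \<in> borel_measurable (P x \<Otimes>\<^sub>M lborel)"
    by (simp only: case_prod_beta')
  from lborel.borel_measurable_lebesgue_integral[OF this] show ?thesis
    by (simp only: eq[abs_def])
qed

text \<open>Dynkin's formula for \<open>V\<close> at the cutoff times \<open>S n\<close>, as \<open>n\<close> tends to infinity. Almost surely the
  hitting time is finite, so that \<open>S n\<close> is eventually equal to it and the process then sits in \<open>y\<close>.\<close>

lemma poisson_solution_difference:
  fixes V f :: "'a \<Rightarrow> real"
  assumes "irreducible_rates k" and f0: "mean \<rho> f = 0" and V: "\<And>z. generator k V z + f z = 0"
  shows "integrable (P x) (accumulated_excess X \<rho> f y)"
    and "V x - V y = (\<integral>\<omega>. accumulated_excess X \<rho> f y \<omega> \<partial>P x)"
    and "ennreal \<bar>V x - V y\<bar> \<le> ennreal (centered_norm \<rho> f) * mean_first_passage_time P X x y"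
proof -
  let ?T = "escape_time X (UNIV - {y})"
  let ?S = "\<lambda>n. stopped_time (real (Suc n)) y"
  let ?A = "accumulated_excess X \<rho> f y"
  let ?C = "centered_norm \<rho> f"
  have C: "\<bar>f z\<bar> \<le> ?C" for z
    unfolding centered_norm_def f0 by (intro Max_ge) auto
  have C0: "0 \<le> ?C" using C[of y] by linarith
  have finite_mean: "(\<integral>\<^sup>+\<omega>. e2ennreal (?T \<omega>) \<partial>P x) < \<infinity>"
    using mean_first_passage_time_finite[OF assms(1)] unfolding mean_first_passage_time_def .
  have meas_T: "?T \<in> borel_measurable (P x)" by (rule borel_measurable_escape_time)
  have meas_eT: "(\<lambda>\<omega>. e2ennreal (?T \<omega>)) \<in> borel_measurable (P x)"
    using meas_T by measurable
  have "AE \<omega> in P x. e2ennreal (?T \<omega>) \<noteq> \<infinity>"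
    using finite_mean by (intro nn_integral_PInf_AE meas_eT) simp
  then have fin: "AE \<omega> in P x. \<bar>?T \<omega>\<bar> \<noteq> \<infinity>"
  proof (rule eventually_mono)
    fix \<omega> assume "e2ennreal (?T \<omega>) \<noteq> \<infinity>"
    then show "\<bar>?T \<omega>\<bar> \<noteq> \<infinity>" using escape_time_nonneg[of "UNIV - {y}" \<omega>] by (cases "?T \<omega>") auto
  qed
  have real_T: "ennreal (real_of_ereal (?T \<omega>)) = e2ennreal (?T \<omega>)" if "\<bar>?T \<omega>\<bar> \<noteq> \<infinity>" for \<omega>
    using that by (cases "?T \<omega>") auto
  have int_T: "integrable (P x) (\<lambda>\<omega>. real_of_ereal (?T \<omega>))"
  proof (rule integrableI_nonneg)
    show "(\<lambda>\<omega>. real_of_ereal (?T \<omega>)) \<in> borel_measurable (P x)"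
      using meas_T by (rule borel_measurable_real_of_ereal)
    show "AE \<omega> in P x. 0 \<le> real_of_ereal (?T \<omega>)"
      by (rule AE_I2) (rule real_of_ereal_pos[OF escape_time_nonneg])
    have "(\<integral>\<^sup>+\<omega>. ennreal (real_of_ereal (?T \<omega>)) \<partial>P x) = (\<integral>\<^sup>+\<omega>. e2ennreal (?T \<omega>) \<partial>P x)"
      by (rule nn_integral_cong_AE) (rule eventually_mono[OF fin real_T])
    then show "(\<integral>\<^sup>+\<omega>. ennreal (real_of_ereal (?T \<omega>)) \<partial>P x) < \<infinity>" using finite_mean by simp
  qed
  have S_eq: "?S n \<omega> = r" if "?T \<omega> = ereal r" "r \<le> real (Suc n)" for n \<omega> r
    using that unfolding stopped_time_def by (simp add: min_def)
  have S_ev: "\<forall>\<^sub>F n in sequentially. ?S n \<omega> = r" if "?T \<omega> = ereal r" for \<omega> r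
  proof -
    obtain N :: nat where "r \<le> real N" using real_arch_simple by blast
    then show ?thesis using S_eq[OF that] unfolding eventually_sequentially
      by (intro exI[of _ N]) force
  qed
  have L: "generator k V z = - f z" for z using V[of z] by simp
  have meas_A: "?A \<in> borel_measurable (P x)" by (rule borel_measurable_accumulated_excess)
  let ?I = "\<lambda>n \<omega>. LBINT s:{0..<?S n \<omega>}. generator k V (X s \<omega>)"
  note dynkin = dynkin_formula[where u = V and x = x and y = y]
  have pos: "0 < real (Suc n)" for n by simp
  have lim_I: "AE \<omega> in P x. (\<lambda>n. ?I n \<omega>) \<longlonglongrightarrow> - ?A \<omega>"
    using fin
  proof (rule eventually_mono)
    fix \<omega> assume "\<bar>?T \<omega>\<bar> \<noteq> \<infinity>"
    then obtain r where r: "?T \<omega> = ereal r" by auto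
    have A: "- ?A \<omega> = (LBINT s:{0..<r}. generator k V (X s \<omega>))"
      unfolding accumulated_excess_eq[OF f0 r] L set_lebesgue_integral_def by simp
    show "(\<lambda>n. ?I n \<omega>) \<longlonglongrightarrow> - ?A \<omega>"
      unfolding A by (rule tendsto_eventually) (rule eventually_mono[OF S_ev[OF r]], simp)
  qed
  have bound_I: "AE \<omega> in P x. norm (?I n \<omega>) \<le> ?C * real_of_ereal (?T \<omega>)" for n
    using fin AE_space
  proof eventually_elim
    fix \<omega> assume "\<bar>?T \<omega>\<bar> \<noteq> \<infinity>" and \<omega>: "\<omega> \<in> space (P x)"
    then obtain r where r: "?T \<omega> = ereal r" by auto
    have "ereal (?S n \<omega>) \<le> ereal r" by (subst ereal_stopped_time) (simp_all add: r)
    then have "?S n \<omega> \<le> r" by simp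
    have S0: "0 \<le> ?S n \<omega>" by (rule stopped_time_bounds) simp
    have "\<bar>?I n \<omega>\<bar> \<le> ?C * (?S n \<omega> - 0)"
      using \<omega> order_refl S0 by (rule path_integral_bound) (simp add: L C)
    also have "\<dots> \<le> ?C * real_of_ereal (?T \<omega>)"
      using C0 \<open>?S n \<omega> \<le> r\<close> r by (intro mult_left_mono) simp_all
    finally show "norm (?I n \<omega>) \<le> ?C * real_of_ereal (?T \<omega>)" by simp
  qed
  have int_CT: "integrable (P x) (\<lambda>\<omega>. ?C * real_of_ereal (?T \<omega>))"
    using int_T by (rule integrable_mult_right)
  have meas_I: "?I n \<in> borel_measurable (P x)" for n
    using dynkin(2)[OF pos] by (rule borel_measurable_integrable)
  have meas_A': "(\<lambda>\<omega>. - ?A \<omega>) \<in> borel_measurable (P x)"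
    using meas_A by (rule borel_measurable_uminus)
  have "integrable (P x) (\<lambda>\<omega>. - ?A \<omega>)"
    using meas_A' meas_I int_CT lim_I bound_I by (rule integrable_dominated_convergence)
  then show int_A: "integrable (P x) ?A" by simp
  have lim1: "(\<lambda>n. \<integral>\<omega>. ?I n \<omega> \<partial>P x) \<longlonglongrightarrow> (\<integral>\<omega>. - ?A \<omega> \<partial>P x)"
    using meas_A' meas_I int_CT lim_I bound_I by (rule integral_dominated_convergence)
  obtain C' where C': "0 \<le> C'" "\<And>z. \<bar>V z\<bar> \<le> C'"
    using finite_type_bounded[of V] by metis
  have lim2: "(\<lambda>n. \<integral>\<omega>. V (X (?S n \<omega>) \<omega>) \<partial>P x) \<longlonglongrightarrow> (\<integral>\<omega>. V y \<partial>P x)"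
  proof (rule integral_dominated_convergence[where w = "\<lambda>_. C'"])
    show "(\<lambda>\<omega>. V (X (?S n \<omega>) \<omega>)) \<in> borel_measurable (P x)" for n
      using dynkin(1)[OF pos] by (rule borel_measurable_integrable)
    show "AE \<omega> in P x. (\<lambda>n. V (X (?S n \<omega>) \<omega>)) \<longlonglongrightarrow> V y"
      using fin AE_space
    proof eventually_elim
      fix \<omega> assume "\<bar>?T \<omega>\<bar> \<noteq> \<infinity>" and \<omega>: "\<omega> \<in> space (P x)"
      then obtain r where r: "?T \<omega> = ereal r" by auto
      show "(\<lambda>n. V (X (?S n \<omega>) \<omega>)) \<longlonglongrightarrow> V y"
        by (rule tendsto_eventually) (rule eventually_mono[OF S_ev[OF r]], simp add: X_escape_time[OF \<omega> r])
    qed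
    show "AE \<omega> in P x. norm (V (X (?S n \<omega>) \<omega>)) \<le> C'" for n
      unfolding real_norm_def by (rule AE_I2) (rule C'(2))
  qed (rule P.integrable_const borel_measurable_const)+
  have "(\<lambda>n. (\<integral>\<omega>. V (X (?S n \<omega>) \<omega>) \<partial>P x) - V x) \<longlonglongrightarrow> (\<integral>\<omega>. V y \<partial>P x) - V x"
    by (intro tendsto_intros lim2)
  then have "(\<integral>\<omega>. V y \<partial>P x) - V x = (\<integral>\<omega>. - ?A \<omega> \<partial>P x)"
    unfolding dynkin(3)[OF pos] using lim1 by (rule LIMSEQ_unique)
  then show V_eq: "V x - V y = (\<integral>\<omega>. ?A \<omega> \<partial>P x)"
    by (simp add: P.prob_space)
  have "ennreal \<bar>V x - V y\<bar> \<le> (\<integral>\<^sup>+\<omega>. ennreal (norm (?A \<omega>)) \<partial>P x)"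
    unfolding V_eq using integral_norm_bound_ennreal[OF int_A] by simp
  also have "\<dots> \<le> (\<integral>\<^sup>+\<omega>. ennreal ?C * e2ennreal (?T \<omega>) \<partial>P x)"
  proof (rule nn_integral_mono_AE)
    show "AE \<omega> in P x. ennreal (norm (?A \<omega>)) \<le> ennreal ?C * e2ennreal (?T \<omega>)"
      using fin AE_space
    proof eventually_elim
      fix \<omega> assume fin: "\<bar>?T \<omega>\<bar> \<noteq> \<infinity>" and \<omega>: "\<omega> \<in> space (P x)"
      then obtain r where r: "?T \<omega> = ereal r" by auto
      have r0: "0 \<le> r" using escape_time_nonneg[of "UNIV - {y}" \<omega>] r by simp
      have "\<bar>?A \<omega>\<bar> \<le> ?C * (r - 0)"
        unfolding accumulated_excess_eq[OF f0 r] using \<omega> order_refl r0 C by (rule path_integral_bound)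
      then have "ennreal (norm (?A \<omega>)) \<le> ennreal (?C * r)" by (simp add: ennreal_leI)
      also have "\<dots> = ennreal ?C * e2ennreal (?T \<omega>)" using C0 r0 by (simp add: r ennreal_mult)
      finally show "ennreal (norm (?A \<omega>)) \<le> ennreal ?C * e2ennreal (?T \<omega>)" .
    qed
  qed
  also have "\<dots> = ennreal ?C * mean_first_passage_time P X x y"
    unfolding mean_first_passage_time_def by (rule nn_integral_cmult[OF meas_eT])
  finally show "ennreal \<bar>V x - V y\<bar> \<le> ennreal ?C * mean_first_passage_time P X x y" .
qed

end

theorem theoremV1:
  fixes k :: "'a::finite \<Rightarrow> 'a \<Rightarrow> real"
    and P :: "'a \<Rightarrow> 'w measure"
    and X :: "real \<Rightarrow> 'w \<Rightarrow> 'a"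
    and \<rho> f V :: "'a \<Rightarrow> real"
  assumes "markov_jump_process k P X"
    and "irreducible_rates k"
    and "stationary_distribution k \<rho>"
    and "mean \<rho> f = 0"
    and "\<forall>x. generator k V x + f x = 0"
    and "mean \<rho> V = 0"
  shows "\<forall>x y.
      integrable (P x) (accumulated_excess X \<rho> f y) \<and>
      V x - V y = v_tilde P X \<rho> f x y \<and>
      mean_first_passage_time P X x y < \<infinity> \<and>
      ennreal \<bar>V x - V y\<bar> \<le> ennreal (centered_norm \<rho> f) *
        min (mean_first_passage_time P X x y) (mean_first_passage_time P X y x)"
proof (intro allI conjI)
  fix x y
  interpret markov_jump_process k P X by fact
  have V: "generator k V z + f z = 0" for z using assms(5) by blast
  note main = poisson_solution_difference[OF assms(2,4) V]
  show "integrable (P x) (accumulated_excess X \<rho> f y)" by (rule main(1))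
  show "V x - V y = v_tilde P X \<rho> f x y" unfolding v_tilde_def by (rule main(2))
  show "mean_first_passage_time P X x y < \<infinity>" using assms(2) by (rule mean_first_passage_time_finite)
  show "ennreal \<bar>V x - V y\<bar> \<le> ennreal (centered_norm \<rho> f) *
        min (mean_first_passage_time P X x y) (mean_first_passage_time P X y x)"
    using main(3)[of x y] main(3)[of y x]
    unfolding min_def abs_minus_commute[of "V y"] by simp
qed

end
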